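(* Let $\mathcal G:\mathscr P_2(\mathbb R^d)\to\mathbb R$ be Lipschitz continuous and, for $\epsilon>0$, let $\mathcal G^\epsilon$ be its Lasry--Lions regularization. Let $\mu^\epsilon\to\mu$ in $\mathscr P_2(\mathbb R^d)$ as $\epsilon\searrow0$ and set $\Xi^\epsilon:=\nabla_\mu\mathcal G^\epsilon(\mu^\epsilon)\in L^2_{\mu^\epsilon}$. Let $\gamma^\epsilon\in\Gamma(\mu,\mu^\epsilon)$ be such that $\|\pi^2-\pi^1\|_{\gamma^\epsilon}\to0$ as $\epsilon\searrow0$. Then $\{\mathsf P_{\gamma^\epsilon}\Xi^\epsilon\}_\epsilon$ is bounded in $L^2_\mu$ and any of its weak limit points (as $\epsilon\searrow0$) belongs to $\partial_C\mathcal G(\mu)$.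
   Context: $\mathscr P_2(\mathbb R^d)$ is the space of Borel probability measures on $\mathbb R^d$ with finite second moment, with the 2-Wasserstein distance; $\Gamma(\mu,\nu)$ is the set of all couplings; $\|\pi^2-\pi^1\|_\gamma^2=\int|y-x|^2d\gamma(x,y)$; $L^2_\mu$ is the space of $\mu$-square-integrable maps $\mathbb R^d\to\mathbb R^d$ with inner product $\langle\cdot,\cdot\rangle_\mu$. Lasry--Lions regularization: $(\Omega,\mathbb P)$ is a fixed complete non-atomic probability space with $\Omega$ Polish, $L^2_{\mathbb P}$ the Hilbert space of square-integrable $\mathbb R^d$-valued random variables, $\hat{\mathcal G}(X):=\mathcal G(X_\#\mathbb P)$ the lift, and $$\mathcal G^\epsilon(\mu):=\inf_{Z\in L^2_{\mathbb P}}\sup_{Y\in L^2_{\mathbb P}}\Big\{\hat{\mathcal G}(Y)-\frac1{2\epsilon}|Z-Y|^2+\frac1\epsilon|Z-X|^2\Big\},\qquad X_\#\mathbb P=\mu,$$ which does not depend on the choice of $X$; $\mathcal G^\epsilon$ is differentiable everywhere. Differentiability: $\mathcal G$ is differentiable at $\mu$ with gradient $\nabla_\mu\mathcal G(\mu)=\xi\in L^2_\mu$ if for all $\gamma\in\mathscr P_2(\mathbb R^{2d})$ with first marginal $\mu$, $\mathcal G(\pi^2_\#\gamma)=\mathcal G(\mu)+\int\langle\xi(x),y-x\rangle d\gamma(x,y)+o(\|\pi^2-\pi^1\|_\gamma)$. Pullback map: for $\gamma\in\Gamma(\mu,\nu)$, $\gamma(dx,dy)=\mu(dx)\gamma_x(dy)$,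 $\mathsf P_\gamma:L^2_\nu\to L^2_\mu$ is $\mathsf P_\gamma\beta(x):=\int\beta(y)\gamma_x(dy)$. Clarke subdifferential: let $C_1(\mathbb R^d;\mathbb R^d)$ be the set of continuous maps $w$ with $\sup_x|w(x)|/(1+|x|)<\infty$; $D\mathcal G(\mu)(w):=\limsup_{\nu\to\mu,\ t\searrow0}\frac{\mathcal G((\mathrm{id}+tw)_\#\nu)-\mathcal G(\nu)}{t}$ and $\partial_C\mathcal G(\mu):=\{\Xi\in L^2_\mu:\ \langle\Xi,w\rangle_\mu\le D\mathcal G(\mu)(w)\ \ \forall w\in C_1(\mathbb R^d;\mathbb R^d)\}$. *)

theory Defs
  imports "HOL-Probability.Probability"
begin

text \<open>
  Elements of \<open>L\<^sup>2\<close> are represented by measurable functions (not by equivalence classes);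
  all notions below are insensitive to changes on null sets.
\<close>

definition L2 :: "'b measure \<Rightarrow> ('b \<Rightarrow> 'a::euclidean_space) set" where
  "L2 M = {f \<in> borel_measurable M. integrable M (\<lambda>x. (norm (f x))\<^sup>2)}"

definition L2_inner :: "'b measure \<Rightarrow> ('b \<Rightarrow> 'a::euclidean_space) \<Rightarrow> ('b \<Rightarrow> 'a) \<Rightarrow> real" where
  "L2_inner M f g = (LINT x|M. f x \<bullet> g x)"

definition L2_norm :: "'b measure \<Rightarrow> ('b \<Rightarrow> 'a::euclidean_space) \<Rightarrow> real" where
  "L2_norm M f = sqrt (LINT x|M. (norm (f x))\<^sup>2)"

definition L2_weakly_tendsto ::
    "'b measure \<Rightarrow> (nat \<Rightarrow> 'b \<Rightarrow> 'a::euclidean_space) \<Rightarrow> ('b \<Rightarrow> 'a) \<Rightarrow> bool" where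
  "L2_weakly_tendsto M f g \<longleftrightarrow>
     (\<forall>n. f n \<in> L2 M) \<and> g \<in> L2 M \<and>
     (\<forall>h\<in>L2 M. (\<lambda>n. L2_inner M (f n) h) \<longlonglongrightarrow> L2_inner M g h)"


section \<open>The Wasserstein space\<close>

definition P2 :: "'a::euclidean_space measure set" where
  "P2 = {\<mu>. sets \<mu> = sets borel \<and> prob_space \<mu> \<and> integrable \<mu> (\<lambda>x. (norm x)\<^sup>2)}"

definition couplings ::
    "'a::euclidean_space measure \<Rightarrow> 'a measure \<Rightarrow> ('a \<times> 'a) measure set" where
  "couplings \<mu> \<nu> =
     {\<gamma>. sets \<gamma> = sets borel \<and> prob_space \<gamma> \<and> distr \<gamma> borel fst = \<mu> \<and> distr \<gamma> borel snd = \<nu>}"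

text \<open>The displacement \<open>\<parallel>\<pi>\<^sup>2 - \<pi>\<^sup>1\<parallel>\<^sub>\<gamma>\<close>.\<close>

definition displacement :: "('a::euclidean_space \<times> 'a) measure \<Rightarrow> real" where
  "displacement \<gamma> = L2_norm \<gamma> (\<lambda>(x, y). y - x)"

definition W2 :: "'a::euclidean_space measure \<Rightarrow> 'a measure \<Rightarrow> real" where
  "W2 \<mu> \<nu> = (INF \<gamma>\<in>couplings \<mu> \<nu>. displacement \<gamma>)"

definition nhds_W2 :: "'a::euclidean_space measure \<Rightarrow> 'a measure filter" where
  "nhds_W2 \<mu> = (INF r\<in>{0<..}. principal {\<nu>\<in>P2. W2 \<nu> \<mu> < r})"

definition W2_Lipschitz :: "('a::euclidean_space measure \<Rightarrow> real) \<Rightarrow> bool" where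
  "W2_Lipschitz G \<longleftrightarrow> (\<exists>L. \<forall>\<mu>\<in>P2. \<forall>\<nu>\<in>P2. \<bar>G \<mu> - G \<nu>\<bar> \<le> L * W2 \<mu> \<nu>)"

definition has_W2_gradient ::
    "('a::euclidean_space measure \<Rightarrow> real) \<Rightarrow> ('a \<Rightarrow> 'a) \<Rightarrow> 'a measure \<Rightarrow> bool" where
  "has_W2_gradient G \<xi> \<mu> \<longleftrightarrow>
     \<xi> \<in> L2 \<mu> \<and>
     (\<forall>\<eta>>0. \<exists>\<delta>>0. \<forall>\<gamma>\<in>P2. distr \<gamma> borel fst = \<mu> \<longrightarrow> displacement \<gamma> \<le> \<delta> \<longrightarrow>
        \<bar>G (distr \<gamma> borel snd) - G \<mu> - (LINT (x, y)|\<gamma>. \<xi> x \<bullet> (y - x))\<bar> \<le> \<eta> * displacement \<gamma>)"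


section \<open>Disintegration and pullback\<close>

text \<open>\<open>\<gamma>(dx,dy) = \<mu>(dx) \<kappa>\<^sub>x(dy)\<close>\<close>

definition disintegration ::
    "('a::euclidean_space \<times> 'a) measure \<Rightarrow> 'a measure \<Rightarrow> ('a \<Rightarrow> 'a measure) \<Rightarrow> bool" where
  "disintegration \<gamma> \<mu> \<kappa> \<longleftrightarrow>
     \<kappa> \<in> \<mu> \<rightarrow>\<^sub>M prob_algebra borel \<and>
     (\<forall>C\<in>sets borel. emeasure \<gamma> C = (\<integral>\<^sup>+x. emeasure (\<kappa> x) {y. (x, y) \<in> C} \<partial>\<mu>))"

definition pullback ::
    "('a::euclidean_space \<Rightarrow> 'a measure) \<Rightarrow> ('a \<Rightarrow> 'a) \<Rightarrow> 'a \<Rightarrow> 'a" where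
  "pullback \<kappa> \<beta> = (\<lambda>x. LINT y|\<kappa> x. \<beta> y)"


section \<open>Lasry--Lions regularization\<close>

definition nonatomic :: "'w measure \<Rightarrow> bool" where
  "nonatomic M \<longleftrightarrow>
     (\<forall>A\<in>sets M. 0 < emeasure M A \<longrightarrow>
        (\<exists>B\<in>sets M. B \<subseteq> A \<and> 0 < emeasure M B \<and> emeasure M B < emeasure M A))"

definition lift :: "'w measure \<Rightarrow> ('a::euclidean_space measure \<Rightarrow> real) \<Rightarrow> ('w \<Rightarrow> 'a) \<Rightarrow> real" where
  "lift P G X = G (distr P borel X)"

text \<open>
  The inf-sup is taken in the extended reals, so that it is meaningful without any
  boundedness conditions; for Lipschitz \<open>G\<close> and \<open>\<epsilon> > 0\<close> its value is finite.
\<close>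

definition lasry_lions_lift ::
    "'w measure \<Rightarrow> ('a::euclidean_space measure \<Rightarrow> real) \<Rightarrow> real \<Rightarrow> ('w \<Rightarrow> 'a) \<Rightarrow> ereal" where
  "lasry_lions_lift P G \<epsilon> X =
     (INF Z\<in>L2 P. SUP Y\<in>L2 P.
        ereal (lift P G Y - 1 / (2 * \<epsilon>) * (L2_norm P (\<lambda>\<omega>. Z \<omega> - Y \<omega>))\<^sup>2
                 + 1 / \<epsilon> * (L2_norm P (\<lambda>\<omega>. Z \<omega> - X \<omega>))\<^sup>2))"

definition lasry_lions ::
    "'w measure \<Rightarrow> ('a::euclidean_space measure \<Rightarrow> real) \<Rightarrow> real \<Rightarrow> 'a measure \<Rightarrow> real" where
  "lasry_lions P G \<epsilon> \<mu> =
     real_of_ereal (lasry_lions_lift P G \<epsilon> (SOME X. X \<in> L2 P \<and> distr P borel X = \<mu>))"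


section \<open>Clarke subdifferential\<close>

definition C1_maps :: "('a::euclidean_space \<Rightarrow> 'a) set" where
  "C1_maps = {w. continuous_on UNIV w \<and> bdd_above (range (\<lambda>x. norm (w x) / (1 + norm x)))}"

definition clarke_deriv ::
    "('a::euclidean_space measure \<Rightarrow> real) \<Rightarrow> 'a measure \<Rightarrow> ('a \<Rightarrow> 'a) \<Rightarrow> ereal" where
  "clarke_deriv G \<mu> w =
     Limsup (nhds_W2 \<mu> \<times>\<^sub>F at_right 0)
       (\<lambda>(\<nu>, t). ereal ((G (distr \<nu> borel (\<lambda>x. x + t *\<^sub>R w x)) - G \<nu>) / t))"

definition clarke_subdiff ::
    "('a::euclidean_space measure \<Rightarrow> real) \<Rightarrow> 'a measure \<Rightarrow> ('a \<Rightarrow> 'a) set" where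
  "clarke_subdiff G \<mu> =
     {\<Xi> \<in> L2 \<mu>. \<forall>w\<in>C1_maps. ereal (L2_inner \<mu> \<Xi> w) \<le> clarke_deriv G \<mu> w}"

end

theory Submission
  imports Defs
begin

text \<open>
  Replacing \<open>(X, Z, Y)\<close> by \<open>(X + W, Z + W, Y + W)\<close> leaves both quadratic penalties of the inf-sup
  unchanged. With \<open>Z\<close> nearly optimal for \<open>X\<close> and \<open>Y + W\<close> nearly optimal for \<open>(X + W, Z + W)\<close>, this gives
  \<open>\<G>\<^sup>\<epsilon>(X + W) - \<G>\<^sup>\<epsilon>(X) \<le> \<G>(Y + W) - \<G>(Y)\<close> up to a small error, where \<open>|Y - X| = O(\<epsilon>)\<close> because
  \<open>\<G>\<close> is Lipschitz. In particular \<open>\<G>\<^sup>\<epsilon>\<close> inherits the Lipschitz constant of \<open>\<G>\<close>, which bounds the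
  gradients, and pulling back is a contraction by Jensen's inequality.

  For the second claim let \<open>(X\<^sub>0, X)\<close> have law \<open>\<gamma>\<^sup>\<epsilon>\<close> and take \<open>W = t w(X\<^sub>0)\<close>. Dividing by \<open>t\<close>, the left-hand
  side tends to \<open>\<langle>P\<^sub>\<gamma>\<Xi>\<^sup>\<epsilon>, w\<rangle>\<close>, while the right-hand side is a difference quotient of \<open>\<G>\<close> at the law of
  \<open>Y\<close>, which is close to \<open>\<mu>\<close>, in the direction \<open>w\<close>, up to the error \<open>|w(Y) - w(X\<^sub>0)|\<close>, which
  vanishes as \<open>|Y - X\<^sub>0| \<rightarrow> 0\<close>.

  Since every point of the Polish space \<open>\<Omega>\<close> is a null set, an injective Borel map \<open>\<Omega> \<rightarrow> \<real>\<close> composed with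
  its own distribution function is uniformly distributed, so every law is realized on \<open>\<Omega>\<close>.
\<close>

section \<open>The spaces of square-integrable maps\<close>

lemma measurable_fst_borel [measurable]: "fst \<in> borel_measurable (borel ::
    ('a::euclidean_space \<times> 'b::euclidean_space) measure)"
  by (rule borel_measurable_continuous_onI) (intro continuous_intros)

lemma measurable_snd_borel [measurable]: "snd \<in> borel_measurable (borel ::
    ('a::euclidean_space \<times> 'b::euclidean_space) measure)"
  by (rule borel_measurable_continuous_onI) (intro continuous_intros)

lemma L2I: "f \<in> borel_measurable M \<Longrightarrow> integrable M (\<lambda>x. (norm (f x))\<^sup>2) \<Longrightarrow> f \<in> L2 M"
  by (simp add: L2_def)

lemma L2_measurable [measurable_dest]: "f \<in> L2 M \<Longrightarrow> f \<in> borel_measurable M"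
  by (simp add: L2_def)

lemma L2_integrable: "f \<in> L2 M \<Longrightarrow> integrable M (\<lambda>x. (norm (f x))\<^sup>2)"
  by (simp add: L2_def)

lemma norm_add_power2_le: "(norm (a + b))\<^sup>2 \<le> 2 * (norm a)\<^sup>2 + 2 * (norm (b::'a::real_normed_vector))\<^sup>2"
proof -
  have "(norm (a + b))\<^sup>2 \<le> (norm a + norm b)\<^sup>2"
    by (intro power_mono norm_triangle_ineq) simp
  also have "\<dots> \<le> 2 * (norm a)\<^sup>2 + 2 * (norm b)\<^sup>2"
    using sum_squares_bound[of "norm a" "norm b"] by (simp add: power2_sum)
  finally show ?thesis .
qed

lemma L2_bound:
  assumes "g \<in> borel_measurable M" "integrable M h" "AE x in M. (norm (g x))\<^sup>2 \<le> h x"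
  shows "g \<in> L2 M"
proof (rule L2I[OF assms(1)])
  note [measurable] = assms(1)
  show "integrable M (\<lambda>x. (norm (g x))\<^sup>2)"
    by (rule Bochner_Integration.integrable_bound[OF assms(2)])
       (measurable, use assms(3) in \<open>auto\<close>)
qed

lemma L2_add: "f \<in> L2 M \<Longrightarrow> g \<in> L2 M \<Longrightarrow> (\<lambda>x. f x + g x) \<in> L2 M"
  by (rule L2_bound[where h="\<lambda>x. 2 * (norm (f x))\<^sup>2 + 2 * (norm (g x))\<^sup>2"])
     (auto intro!: Bochner_Integration.integrable_add integrable_mult_right norm_add_power2_le
       simp: L2_def)

lemma L2_scaleR: "f \<in> L2 M \<Longrightarrow> (\<lambda>x. c *\<^sub>R f x) \<in> L2 M"
  by (auto simp: L2_def power_mult_distrib)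

lemma L2_minus: "f \<in> L2 M \<Longrightarrow> (\<lambda>x. - f x) \<in> L2 M"
  by (auto simp: L2_def)

lemma L2_diff: "f \<in> L2 M \<Longrightarrow> g \<in> L2 M \<Longrightarrow> (\<lambda>x. f x - g x) \<in> L2 M"
  using L2_add[of f M "\<lambda>x. - g x"] L2_minus[of g M] by simp

lemma L2_Pair:
  assumes "f \<in> L2 M" "g \<in> L2 M"
  shows "(\<lambda>x. (f x, g x)) \<in> L2 M"
  using assms by (auto simp: L2_def norm_Pair)

lemma L2_fst:
  assumes "f \<in> L2 M"
  shows "(\<lambda>x. fst (f x)) \<in> L2 M"
proof (rule L2_bound)
  show "(\<lambda>x. fst (f x)) \<in> borel_measurable M"
    using assms by (auto intro: measurable_compose[OF _ measurable_fst_borel] dest: L2_measurable)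
  show "AE x in M. (norm (fst (f x)))\<^sup>2 \<le> (norm (f x))\<^sup>2"
    by (metis (no_types, lifting) AE_I2 norm_ge_zero norm_fst_le power_mono prod.collapse)
qed (rule L2_integrable[OF assms])

lemma L2_snd:
  assumes "f \<in> L2 M"
  shows "(\<lambda>x. snd (f x)) \<in> L2 M"
proof (rule L2_bound)
  show "(\<lambda>x. snd (f x)) \<in> borel_measurable M"
    using assms by (auto intro: measurable_compose[OF _ measurable_snd_borel] dest: L2_measurable)
  show "AE x in M. (norm (snd (f x)))\<^sup>2 \<le> (norm (f x))\<^sup>2"
    by (metis (no_types, lifting) AE_I2 norm_ge_zero norm_snd_le power_mono prod.collapse)
qed (rule L2_integrable[OF assms])

lemma (in finite_measure) L2_const: "(\<lambda>x. c) \<in> L2 M"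
  by (auto simp: L2_def)

lemma L2_inner_integrable:
  assumes "f \<in> L2 M" "g \<in> L2 M"
  shows "integrable M (\<lambda>x. f x \<bullet> g x)"
proof (rule Bochner_Integration.integrable_bound)
  show "integrable M (\<lambda>x. (norm (f x))\<^sup>2 + (norm (g x))\<^sup>2)"
    using assms by (auto simp: L2_def)
  show "(\<lambda>x. f x \<bullet> g x) \<in> borel_measurable M"
    using assms by measurable
  have "norm (f x \<bullet> g x) \<le> norm ((norm (f x))\<^sup>2 + (norm (g x))\<^sup>2)" for x
    using Cauchy_Schwarz_ineq2[of "f x" "g x"] sum_squares_bound[of "norm (f x)" "norm (g x)"]
      mult_nonneg_nonneg[of "norm (f x)" "norm (g x)"]
    by simp
  then show "AE x in M. norm (f x \<bullet> g x) \<le> norm ((norm (f x))\<^sup>2 + (norm (g x))\<^sup>2)"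
    by simp
qed

lemma L2_norm_nonneg [simp]: "0 \<le> L2_norm M f"
  by (simp add: L2_norm_def integral_nonneg_AE)

lemma L2_norm_power2: "(L2_norm M f)\<^sup>2 = (LINT x|M. (norm (f x))\<^sup>2)"
  by (simp add: L2_norm_def integral_nonneg_AE)

lemma L2_norm_scaleR: "L2_norm M (\<lambda>x. c *\<^sub>R f x) = \<bar>c\<bar> * L2_norm M f"
  by (simp add: L2_norm_def power_mult_distrib real_sqrt_mult)

lemma L2_norm_minus_commute: "L2_norm M (\<lambda>x. f x - g x) = L2_norm M (\<lambda>x. g x - f x)"
  by (simp add: L2_norm_def norm_minus_commute)

lemma L2_norm_distr:
  assumes [measurable]: "X \<in> M \<rightarrow>\<^sub>M N" "f \<in> borel_measurable N"
  shows "L2_norm (distr M N X) f = L2_norm M (\<lambda>x. f (X x))"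
  unfolding L2_norm_def by (subst integral_distr) auto

lemma L2_distr_iff:
  assumes [measurable]: "X \<in> M \<rightarrow>\<^sub>M N" "f \<in> borel_measurable N"
  shows "f \<in> L2 (distr M N X) \<longleftrightarrow> (\<lambda>x. f (X x)) \<in> L2 M"
  by (auto simp: L2_def integrable_distr_eq)

lemma L2_norm_le:
  assumes "integrable M h" "AE x in M. (norm (f x))\<^sup>2 \<le> h x" "f \<in> borel_measurable M"
  shows "(L2_norm M f)\<^sup>2 \<le> (LINT x|M. h x)"
  unfolding L2_norm_power2
  using L2_bound[OF assms(3,1,2)] by (intro integral_mono_AE assms L2_integrable)

lemma (in prob_space) L2_norm_le_const:
  assumes "AE x in M. norm (f x) \<le> c" "f \<in> borel_measurable M" "0 \<le> c"
  shows "L2_norm M f \<le> c"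
proof -
  have "(L2_norm M f)\<^sup>2 \<le> (LINT x|M. c\<^sup>2)"
    using assms by (intro L2_norm_le) (auto intro: power_mono)
  then show ?thesis
    using assms(3) by (simp add: prob_space power2_le_iff_abs_le)
qed

text \<open>Minkowski's inequality comes from integrating a weighted Young inequality and choosing
  the best weight. A small \<open>d\<close> keeps the weight finite and positive when a norm
  vanishes; it tends to 0 at the end.\<close>

lemma L2_norm_triangle:
  fixes f g :: "'a \<Rightarrow> 'b::euclidean_space"
  assumes "f \<in> L2 M" "g \<in> L2 M"
  shows "L2_norm M (\<lambda>x. f x + g x) \<le> L2_norm M f + L2_norm M g"
proof -
  define a where "a = L2_norm M f"
  define b where "b = L2_norm M g"
  have ab: "0 \<le> a" "0 \<le> b"
    by (auto simp: a_def b_def)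
  have *: "(L2_norm M (\<lambda>x. f x + g x))\<^sup>2 \<le> (a + b + 2 * d) * (a + b)" if "0 < d" for d
  proof -
    \<comment> \<open>The optimal weight is \<open>b / a\<close>; this is its version regularized by
      \<open>d\<close>.\<close>
    define s where "s = (b + d) / (a + d)"
    have s: "0 < s"
      using ab that by (auto simp: s_def)
    have ne: "a + d \<noteq> 0" "b + d \<noteq> 0"
      using ab that by auto
    have sum: "a + b + 2 * d = (a + d) + (b + d)"
      by simp
    have pt: "(norm (u + v))\<^sup>2 \<le> (1 + s) * (norm u)\<^sup>2 + (1 + 1 / s) * (norm v)\<^sup>2" for u v :: 'b
    proof -
      have "0 \<le> (sqrt s * norm u - norm v / sqrt s)\<^sup>2"
        by simp
      also have "\<dots> = s * (norm u)\<^sup>2 + (norm v)\<^sup>2 / s - 2 * norm u * norm v"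
        using s by (simp add: power2_diff power_mult_distrib power_divide)
      finally have "2 * norm u * norm v \<le> s * (norm u)\<^sup>2 + (norm v)\<^sup>2 / s"
        by simp
      moreover have "(norm (u + v))\<^sup>2 \<le> (norm u + norm v)\<^sup>2"
        by (intro power_mono norm_triangle_ineq) simp
      ultimately show ?thesis
        by (simp add: power2_sum algebra_simps)
    qed
    have "(L2_norm M (\<lambda>x. f x + g x))\<^sup>2
        \<le> (LINT x|M. (1 + s) * (norm (f x))\<^sup>2 + (1 + 1 / s) * (norm (g x))\<^sup>2)"
      using assms by (intro L2_norm_le) (auto simp: L2_def intro!: pt)
    also have "\<dots> = (1 + s) * a\<^sup>2 + (1 + 1 / s) * b\<^sup>2"
      using assms by (subst Bochner_Integration.integral_add)
        (auto simp: L2_def a_def b_def L2_norm_power2)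
    also have "1 + s = (a + b + 2 * d) / (a + d)"
      unfolding s_def sum add_divide_distrib[of "a + d"] using ne by simp
    also have "1 + 1 / s = (a + b + 2 * d) / (b + d)"
      unfolding s_def sum add_divide_distrib[of "a + d"] using ne by simp
    also have "(a + b + 2 * d) / (a + d) * a\<^sup>2 + (a + b + 2 * d) / (b + d) * b\<^sup>2
      = (a + b + 2 * d) * (a * (a / (a + d))) + (a + b + 2 * d) * (b * (b / (b + d)))"
      by (simp add: power2_eq_square)
    also have "\<dots>
      \<le> (a + b + 2 * d) * (a * 1) + (a + b + 2 * d) * (b * 1)"
      using ab that by (intro add_mono mult_left_mono) auto
    finally show ?thesis
      by (simp add: algebra_simps)
  qed
  have lim: "((\<lambda>d. (a + b + 2 * d) * (a + b)) \<longlongrightarrow> (a + b + 2 * 0) * (a + b)) (at_right 0)"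
    by (intro tendsto_intros)
  have "\<forall>\<^sub>F d in at_right 0. (L2_norm M (\<lambda>x. f x + g x))\<^sup>2 \<le> (a + b + 2 * d) * (a + b)"
    using eventually_at_right_less[of "0::real"] by (rule eventually_mono) (rule *)
  then have "(L2_norm M (\<lambda>x. f x + g x))\<^sup>2 \<le> (a + b + 2 * 0) * (a + b)"
    by (rule tendsto_lowerbound[OF lim]) simp
  also have "\<dots> = (a + b)\<^sup>2"
    by (simp add: power2_eq_square)
  finally show ?thesis
    unfolding a_def[symmetric] b_def[symmetric] by (rule power2_le_imp_le) (use ab in simp)
qed

lemma L2_norm_triangle_diff:
  assumes "f \<in> L2 M" "g \<in> L2 M" "h \<in> L2 M"
  shows "L2_norm M (\<lambda>x. f x - h x) \<le> L2_norm M (\<lambda>x. f x - g x) + L2_norm M (\<lambda>x. g x - h x)"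
  using L2_norm_triangle[of "\<lambda>x. f x - g x" M "\<lambda>x. g x - h x"] assms by (simp add: L2_diff)


section \<open>Laws of random variables\<close>

lemma P2_iff: "\<mu> \<in> P2 \<longleftrightarrow> sets \<mu> = sets borel \<and> prob_space \<mu> \<and> (\<lambda>x. x) \<in> L2 \<mu>"
  by (auto simp: P2_def L2_def measurable_ident_sets)

lemma (in prob_space) distr_in_P2_iff:
  assumes [measurable]: "X \<in> borel_measurable M"
  shows "distr M borel X \<in> P2 \<longleftrightarrow> X \<in> L2 M"
  using L2_distr_iff[OF assms, of "\<lambda>x. x"] by (simp add: P2_iff prob_space_distr)

lemma (in prob_space) L2_distr_P2: "X \<in> L2 M \<Longrightarrow> distr M borel X \<in> P2"
  by (simp add: distr_in_P2_iff L2_measurable)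

lemma displacement_distr:
  fixes X Y :: "'b \<Rightarrow> 'a::euclidean_space"
  assumes [measurable]: "X \<in> borel_measurable M" "Y \<in> borel_measurable M"
  shows "displacement (distr M borel (\<lambda>\<omega>. (X \<omega>, Y \<omega>))) = L2_norm M (\<lambda>\<omega>. Y \<omega> - X \<omega>)"
proof -
  have "(\<lambda>(x, y). y - x :: 'a) \<in> borel_measurable (borel \<Otimes>\<^sub>M borel)"
    by measurable
  then have "(\<lambda>(x, y). y - x :: 'a) \<in> borel_measurable borel"
    by (simp add: borel_prod)
  moreover have "(\<lambda>\<omega>. (X \<omega>, Y \<omega>)) \<in> borel_measurable M"
    by measurable
  ultimately show ?thesis
    unfolding displacement_def by (subst L2_norm_distr) auto
qed

lemma (in prob_space) distr_Pair_couplings: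
  fixes X Y :: "'a \<Rightarrow> 'b::euclidean_space"
  assumes [measurable]: "X \<in> borel_measurable M" "Y \<in> borel_measurable M"
  shows "distr M borel (\<lambda>\<omega>. (X \<omega>, Y \<omega>)) \<in> couplings (distr M borel X) (distr M borel Y)"
proof -
  have m: "(\<lambda>\<omega>. (X \<omega>, Y \<omega>)) \<in> borel_measurable M"
    by measurable
  then show ?thesis
    unfolding couplings_def by (auto simp: prob_space_distr distr_distr comp_def)
qed

text \<open>The joint law is a competitor in the infimum, which is bounded below because
  displacements are nonnegative.\<close>

lemma (in prob_space) W2_le_L2_norm:
  fixes X Y :: "'a \<Rightarrow> 'b::euclidean_space"
  assumes "X \<in> borel_measurable M" "Y \<in> borel_measurable M"
  shows "W2 (distr M borel X) (distr M borel Y) \<le> L2_norm M (\<lambda>\<omega>. X \<omega> - Y \<omega>)"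
proof -
  have "W2 (distr M borel X) (distr M borel Y) \<le> displacement (distr M borel (\<lambda>\<omega>. (X \<omega>, Y \<omega>)))"
    unfolding W2_def using distr_Pair_couplings[OF assms]
    by (intro cINF_lower) (auto simp: displacement_def intro!: bdd_belowI[of _ 0])
  then show ?thesis
    unfolding displacement_distr[OF assms] by (subst L2_norm_minus_commute)
qed

section \<open>Realizing prescribed laws\<close>

text \<open>A sequence of sets is encoded in the ternary digits of a real number; using only the digits
  0 and 1 makes the digits recoverable.\<close>

lemma ternary_encoding:
  fixes A :: "nat \<Rightarrow> 'b set"
  shows "\<exists>f::'b \<Rightarrow> real. \<exists>d::nat \<Rightarrow> real \<Rightarrow> bool. (\<forall>n. Measurable.pred borel (d n)) \<and>
    (\<forall>n x. d n (f x) \<longleftrightarrow> x \<in> A n) \<and> (\<forall>M. (\<forall>n. A n \<in> sets M) \<longrightarrow> f \<in> borel_measurable M)"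
proof -
  define f :: "'b \<Rightarrow> real" where "f x = (\<Sum>n. indicator (A n) x / 3 ^ n)" for x
  \<comment> \<open>\<open>d n\<close> tests whether the \<open>n\<close>-th ternary digit is 1. It
    is a Borel test on all of the real line, also off the range of \<open>f\<close>.\<close>
  define d :: "nat \<Rightarrow> real \<Rightarrow> bool" where "d n r \<longleftrightarrow> \<lfloor>3 ^ n * r\<rfloor> mod 3 = 1" for n r
  have summable: "summable (\<lambda>n. indicator (A n) x / 3 ^ n :: real)" for x
  proof (rule summable_comparison_test')
    show "summable (\<lambda>n. (1 / 3 :: real) ^ n)"
      by (rule summable_geometric) simp
    show "norm (indicator (A n) x / 3 ^ n :: real) \<le> (1 / 3) ^ n" for n
      by (simp add: power_one_over indicator_def)
  qed
  have "d n (f x) \<longleftrightarrow> x \<in> A n" for n x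
  proof -
    define a :: "nat \<Rightarrow> real" where "a k = indicator (A k) x" for k
    define b :: "nat \<Rightarrow> int" where "b k = indicator (A k) x" for k
    have a: "0 \<le> a k" "a k \<le> 1" for k
      by (auto simp: a_def indicator_def)
    have ab: "a k = of_int (b k)" for k
      by (auto simp: a_def b_def indicator_def)
    \<comment> \<open>\<open>t\<close> is the expansion after digit \<open>n\<close>, scaled by
      \<open>3 ^ n\<close>. With digits at most 1 it is at most 1/2, so the floor removes it; with
      digits equal to 2 it could reach 1.\<close>
    define t where "t = (\<Sum>k. a (k + Suc n) / 3 ^ Suc k)"
    have a_le: "a (k + Suc n) / 3 ^ Suc k \<le> (1 / 3) * (1 / 3) ^ k" for k
      using divide_right_mono[OF a(2), of "3 ^ Suc k"] by (simp add: power_one_over)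
    have sg: "summable (\<lambda>k. (1 / 3) * (1 / 3 :: real) ^ k)"
      by (intro summable_mult summable_geometric) simp
    have st: "summable (\<lambda>k. a (k + Suc n) / 3 ^ Suc k)"
      by (rule summable_comparison_test'[OF sg]) (use a_le a(1) in simp)
    have "t \<le> (\<Sum>k. (1 / 3) * (1 / 3) ^ k)"
      unfolding t_def by (rule suminf_le[OF a_le st sg])
    also have "\<dots> = 1 / 2"
      by (subst suminf_mult) (auto simp: suminf_geometric)
    finally have t1: "t < 1"
      by simp
    have t0: "0 \<le> t"
      unfolding t_def by (rule suminf_nonneg[OF st]) (simp add: a(1))
    \<comment> \<open>The digits before \<open>n\<close> contribute the integer
      \<open>3 * i\<close>, which vanishes modulo 3 and leaves digit \<open>n\<close>.\<close>
    define i where "i = (\<Sum>k<n. 3 ^ (n - 1 - k) * b k)"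
    have "f x = (\<Sum>k. a (k + Suc n) / 3 ^ (k + Suc n)) + (\<Sum>k<Suc n. a k / 3 ^ k)"
      unfolding f_def a_def by (rule suminf_split_initial_segment[OF summable])
    also have "(\<Sum>k. a (k + Suc n) / 3 ^ (k + Suc n)) = (\<Sum>k. (1 / 3 ^ n) * (a (k + Suc n) / 3 ^ Suc k))"
      by (simp add: power_add mult_ac)
    also have "\<dots> = (1 / 3 ^ n) * t"
      unfolding t_def by (rule suminf_mult[OF st])
    finally have "3 ^ n * f x = t + (\<Sum>k<Suc n. 3 ^ n * (a k / 3 ^ k))"
      by (simp add: distrib_left sum_distrib_left)
    also have "(\<Sum>k<n. 3 ^ n * (a k / 3 ^ k)) = of_int (3 * i)"
      unfolding i_def sum_distrib_left of_int_sum
    proof (rule sum.cong)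
      fix k assume "k \<in> {..<n}"
      then have "(3::real) ^ n = 3 ^ k * (3 * 3 ^ (n - 1 - k))"
        by (simp flip: power_Suc power_add)
      then show "3 ^ n * (a k / 3 ^ k) = of_int (3 * (3 ^ (n - 1 - k) * b k))"
        by (simp add: ab)
    qed simp
    then have "(\<Sum>k<Suc n. 3 ^ n * (a k / 3 ^ k)) = of_int (3 * i + b n)"
      by (simp add: ab)
    finally have "3 ^ n * f x = t + of_int (3 * i + b n)" .
    then have "\<lfloor>3 ^ n * f x\<rfloor> = 3 * i + b n"
      using t0 t1 by (intro floor_unique) auto
    then show ?thesis
      by (auto simp: d_def b_def indicator_def)
  qed
  moreover have "Measurable.pred borel (d n)" for n
    unfolding d_def by measurable
  moreover have "f \<in> borel_measurable M" if A: "\<forall>n. A n \<in> sets M" for M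
  proof -
    have [measurable]: "A n \<in> sets M" for n
      using A by blast
    show ?thesis
      unfolding f_def by measurable
  qed
  ultimately show ?thesis
    by blast
qed

text \<open>The digits of \<open>f x\<close> record which members of a countable base contain
  \<open>x\<close>; in a Hausdorff space these memberships determine the point.\<close>

lemma borel_real_injection:
  obtains f :: "'w::{second_countable_topology, t2_space} \<Rightarrow> real"
  where "f \<in> borel_measurable borel" "inj f"
proof -
  obtain B :: "'w set set" where B: "countable B" "topological_basis B"
    using ex_countable_basis by auto
  have "B \<noteq> {}"
    using topological_basisE[OF B(2) open_UNIV UNIV_I] by blast
  then have AB: "range (from_nat_into B) = B"
    using B(1) by (rule range_from_nat_into)
  then have op: "open (from_nat_into B n)" for n
    using topological_basis_open[OF B(2)] by blast
  obtain f :: "'w \<Rightarrow> real" and d :: "nat \<Rightarrow> real \<Rightarrow> bool"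
    where f: "\<forall>n x. d n (f x) \<longleftrightarrow> x \<in> from_nat_into B n"
      "\<forall>M. (\<forall>n. from_nat_into B n \<in> sets M) \<longrightarrow> f \<in> borel_measurable M"
    using ternary_encoding[of "from_nat_into B"] by blast
  have "inj f"
  proof (rule injI, rule ccontr)
    fix x y assume eq: "f x = f y" and "x \<noteq> y"
    then obtain U where U: "open U" "x \<in> U" "y \<notin> U"
      by (meson hausdorff disjoint_iff)
    then obtain V where V: "V \<in> B" "x \<in> V" "V \<subseteq> U"
      using topological_basisE[OF B(2) U(1,2)] by blast
    then have "V \<in> range (from_nat_into B)"
      by (simp add: AB)
    then obtain n where "V = from_nat_into B n"
      by (rule rangeE)
    then show False
      using f(1)[THEN spec, THEN spec, of n x] f(1)[THEN spec, THEN spec, of n y] eq U V by auto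
  qed
  moreover have "f \<in> borel_measurable borel"
    using op f(2) by simp
  ultimately show thesis
    using that by blast
qed

text \<open>The digits encode membership in the half-spaces \<open>x \<bullet> b < q\<close> with
  \<open>b\<close> a basis vector and \<open>q\<close> rational. Each coordinate is recovered as the
  infimum of the rational thresholds above it.\<close>

lemma euclidean_real_retraction:
  obtains f :: "'a::euclidean_space \<Rightarrow> real" and g :: "real \<Rightarrow> 'a"
  where "f \<in> borel_measurable borel" "g \<in> borel_measurable borel" "\<And>x. g (f x) = x"
proof -
  define I where "I = (Basis :: 'a set) \<times> (\<rat> :: real set)"
  define e where "e = from_nat_into I"
  have "(SOME b. b \<in> Basis, 0) \<in> I"
    by (auto simp: I_def some_in_eq)
  then have e: "range e = I"
    unfolding e_def by (intro range_from_nat_into) (auto simp: I_def countable_rat countable_finite)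
  define A where "A n = {x. x \<bullet> fst (e n) < snd (e n)}" for n
  obtain f :: "'a \<Rightarrow> real" and d :: "nat \<Rightarrow> real \<Rightarrow> bool"
    where dm: "\<forall>n. Measurable.pred borel (d n)" and d: "\<forall>n x. d n (f x) \<longleftrightarrow> x \<in> A n"
      and f: "\<forall>M. (\<forall>n. A n \<in> sets M) \<longrightarrow> f \<in> borel_measurable M"
    using ternary_encoding[of A] by blast
  have [measurable]: "Measurable.pred borel (d n)" for n
    using dm by blast
  \<comment> \<open>A countable infimum in the extended reals is measurable and makes sense for
    every \<open>r\<close>, also where the set of thresholds is empty or unbounded below.\<close>
  define h where "h b r = (INF n. if fst (e n) = b \<and> d n r then ereal (snd (e n)) else \<infinity>)" for b r
  define g where "g r = (\<Sum>b\<in>Basis. real_of_ereal (h b r) *\<^sub>R b)" for r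
  have "h b (f x) = ereal (x \<bullet> b)" if "b \<in> Basis" for b x
    unfolding h_def
  proof (rule antisym)
    show "ereal (x \<bullet> b) \<le> (INF n. if fst (e n) = b \<and> d n (f x) then ereal (snd (e n)) else \<infinity>)"
      by (rule INF_greatest) (auto simp: d A_def)
    show "(INF n. if fst (e n) = b \<and> d n (f x) then ereal (snd (e n)) else \<infinity>) \<le> ereal (x \<bullet> b)"
    proof (rule ereal_le_epsilon2)
      fix s :: real assume "0 < s"
      then obtain q where q: "q \<in> \<rat>" "x \<bullet> b < q" "q < x \<bullet> b + s"
        using Rats_dense_in_real[of "x \<bullet> b" "x \<bullet> b + s"] by auto
      then have "(b, q) \<in> range e"
        using that by (simp add: e I_def)
      then obtain n where n: "(b, q) = e n"
        by (rule rangeE)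
      have "(INF n. if fst (e n) = b \<and> d n (f x) then ereal (snd (e n)) else \<infinity>)
          \<le> (if fst (e n) = b \<and> d n (f x) then ereal (snd (e n)) else \<infinity>)"
        by (rule INF_lower) simp
      also have "\<dots> = q"
        using q by (simp add: d A_def n[symmetric])
      also have "\<dots> \<le> ereal (x \<bullet> b) + ereal s"
        using q by simp
      finally show "(INF n. if fst (e n) = b \<and> d n (f x) then ereal (snd (e n)) else \<infinity>)
          \<le> ereal (x \<bullet> b) + ereal s" .
    qed
  qed
  then have "g (f x) = x" for x
    by (simp add: g_def euclidean_representation)
  moreover have "f \<in> borel_measurable borel"
    using f by (simp add: A_def)
  moreover have "g \<in> borel_measurable borel"
    unfolding g_def h_def by measurable
  ultimately show thesis
    using that by blast
qed

text \<open>The distribution function of an atomless law pushes it to the uniform law on the unit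
  interval, and the quantile function of \<open>N\<close> pushes the uniform law to
  \<open>N\<close>.\<close>

lemma real_distribution_transport:
  fixes M N :: "real measure"
  assumes "real_distribution M" "real_distribution N" and atomless: "\<And>x. measure M {x} = 0"
  obtains T :: "real \<Rightarrow> real" where "T \<in> borel_measurable borel" "distr M borel T = N"
proof -
  interpret M: cdf_distribution M
    using assms(1) by (simp add: cdf_distribution_def)
  interpret N: cdf_distribution N
    using assms(2) by (simp add: cdf_distribution_def)
  let ?U = "restrict_space lborel {0<..<1::real}"
  \<comment> \<open>The inequality \<open>u \<le> M.C (M.I u)\<close> is general. The converse uses
    continuity of \<open>M.C\<close>, which holds without atoms: to the left of \<open>M.I u\<close>
    the values are at most \<open>u\<close>.\<close>
  have cdf_I: "M.C (M.I u) = u" if u: "u \<in> {0<..<1}" for u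
  proof (rule antisym)
    show "u \<le> M.C (M.I u)"
      using M.pseudoinverse[of u "M.I u"] u by simp
    have "(M.C \<longlongrightarrow> M.C (M.I u)) (at_left (M.I u))"
      using M.isCont_cdf[of "M.I u"] atomless by (simp add: isCont_def filterlim_at_split)
    moreover have "\<forall>\<^sub>F x in at_left (M.I u). M.C x \<le> u"
    proof (rule eventually_at_leftI)
      show "M.C x \<le> u" if "x \<in> {M.I u - 1<..<M.I u}" for x
        using M.pseudoinverse[of u x] u that by simp
    qed simp
    ultimately show "M.C (M.I u) \<le> u"
      by (rule tendsto_upperbound) simp
  qed
  \<comment> \<open>The quantile function matters only on the open unit interval; the default 0
    elsewhere gives a Borel map on the whole line.\<close>
  define J where "J u = (if u \<in> {0<..<1} then N.I u else 0)" for u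
  have [measurable]: "J \<in> borel_measurable borel"
    unfolding J_def
    using N.measurable_CI by (subst (asm) measurable_restrict_space_iff[where c=0]) auto
  have [measurable]: "M.I \<in> borel_measurable ?U" "N.I \<in> borel_measurable ?U"
    using M.measurable_CI N.measurable_CI by (simp_all cong: measurable_cong_sets add: sets_restrict_space)
  have "distr M borel (\<lambda>x. J (M.C x)) = distr (distr ?U borel M.I) borel (\<lambda>x. J (M.C x))"
    by (simp only: M.distr_I_eq_M)
  also have "\<dots> = distr ?U borel (\<lambda>u. J (M.C (M.I u)))"
    by (subst distr_distr) (auto simp: comp_def)
  also have "\<dots> = distr ?U borel N.I"
    by (intro distr_cong) (auto simp: space_restrict_space cdf_I J_def)
  also have "\<dots> = N"
    by (rule N.distr_I_eq_M)
  finally show thesis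
    by (intro that[of "\<lambda>x. J (M.C x)"]) measurable
qed

text \<open>The injection \<open>f\<close> moves the problem to the line, where its law is atomless.
  There it is transported to the law of \<open>e\<close> under \<open>\<nu>\<close>, and the left
  inverse \<open>g\<close> of \<open>e\<close> leads back to the Euclidean space.\<close>

lemma realize_law:
  fixes M :: "'w::{second_countable_topology, t2_space} measure" and \<nu> :: "'a::euclidean_space measure"
  assumes "prob_space M" "sets borel \<subseteq> sets M" and null: "\<And>\<omega>. emeasure M {\<omega>} = 0"
    and "prob_space \<nu>" "sets \<nu> = sets borel"
  obtains X where "X \<in> borel_measurable M" "distr M borel X = \<nu>"
proof -
  interpret M: prob_space M by fact
  interpret \<nu>: prob_space \<nu> by fact
  have sp: "space M = UNIV"
    using assms(2) sets.sets_into_space[of UNIV M] by (metis sets.top space_borel subsetD top.extremum_uniqueI)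
  obtain f :: "'w \<Rightarrow> real" where f: "f \<in> borel_measurable borel" "inj f"
    by (rule borel_real_injection)
  have fM [measurable]: "f \<in> borel_measurable M"
    using measurable_mono[of borel borel borel M] f(1) assms(2) sp by auto
  obtain e :: "'a \<Rightarrow> real" and g :: "real \<Rightarrow> 'a" where
    [measurable]: "e \<in> borel_measurable borel" "g \<in> borel_measurable borel" and g: "\<And>x. g (e x) = x"
    using euclidean_real_retraction by metis
  have e\<nu> [measurable]: "e \<in> borel_measurable \<nu>"
    using assms(5) by (simp cong: measurable_cong_sets)
  have "measure (distr M borel f) {x} = 0" for x
  proof -
    \<comment> \<open>Only an inclusion holds: the fibre is empty when \<open>x\<close> is outside
      the range of \<open>f\<close>.\<close>
    have "f -` {x} \<subseteq> {inv f x}"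
      using f(2) by auto
    then have "emeasure M (f -` {x}) \<le> emeasure M {inv f x}"
      using assms(2) by (intro emeasure_mono) auto
    then show ?thesis
      using null[of "inv f x"] by (simp add: measure_def emeasure_distr sp)
  qed
  moreover have "real_distribution (distr M borel f)" "real_distribution (distr \<nu> borel e)"
    by (auto simp: real_distribution_def real_distribution_axioms_def M.prob_space_distr \<nu>.prob_space_distr)
  ultimately obtain T where [measurable]: "T \<in> borel_measurable borel"
    and T: "distr (distr M borel f) borel T = distr \<nu> borel e"
    using real_distribution_transport by metis
  have "distr M borel (\<lambda>\<omega>. g (T (f \<omega>))) = distr (distr (distr M borel f) borel T) borel g"
    by (simp add: distr_distr comp_def)
  also have "\<dots> = distr \<nu> borel (\<lambda>x. x)"
    unfolding T by (simp add: distr_distr comp_def g)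
  also have "\<dots> = \<nu>"
    using assms(5) by (intro distr_id2) simp
  finally show thesis
    by (intro that[of "\<lambda>\<omega>. g (T (f \<omega>))"]) measurable
qed

text \<open>The sigma-algebra may be larger than the Borel one, as for a completion. Non-atomicity
  enters in the form that points are null.\<close>

locale rich_space = prob_space P for P :: "'w::{second_countable_topology, t2_space} measure" +
  assumes borel_subset: "sets borel \<subseteq> sets P"
    and null_singleton: "emeasure P {\<omega>} = 0"
begin

lemma space_P [simp]: "space P = UNIV"
  using borel_subset sets.sets_into_space[of UNIV P]
  by (metis sets.top space_borel subsetD top.extremum_uniqueI)

lemma realize:
  fixes \<nu> :: "'a::euclidean_space measure"
  assumes "\<nu> \<in> P2"
  obtains X where "X \<in> L2 P" "distr P borel X = \<nu>"
proof -
  obtain X where "X \<in> borel_measurable P" "distr P borel X = \<nu>"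
    using realize_law[OF prob_space_axioms borel_subset null_singleton, of \<nu>] assms
    by (auto simp: P2_def)
  then show thesis
    using assms distr_in_P2_iff that by metis
qed

end

section \<open>Approximate transfer of couplings\<close>

lemma emeasure_countable_cells:
  fixes q :: "'b \<Rightarrow> nat"
  assumes [measurable]: "q \<in> M \<rightarrow>\<^sub>M count_space UNIV" "A \<in> sets M"
  shows "emeasure M A = (\<Sum>i. emeasure M ({x\<in>space M. q x = i} \<inter> A))"
proof -
  have "(\<Sum>i. emeasure M ({x\<in>space M. q x = i} \<inter> A)) = emeasure M (\<Union>i. {x\<in>space M. q x = i} \<inter> A)"
    by (rule suminf_emeasure) (auto simp: disjoint_family_on_def)
  also have "(\<Union>i. {x\<in>space M. q x = i} \<inter> A) = A"
    using sets.sets_into_space[OF assms(2)] by auto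
  finally show ?thesis ..
qed

text \<open>A point gets the index of the first element of a dense sequence within
  \<open>\<eta> / 2\<close> of it; points sharing an index are then within
  \<open>\<eta>\<close>.\<close>

lemma small_cells:
  assumes "0 < \<eta>"
  obtains q :: "'a::{metric_space, second_countable_topology} \<Rightarrow> nat"
  where "q \<in> borel \<rightarrow>\<^sub>M count_space UNIV" "\<And>x y. q x = q y \<Longrightarrow> dist x y \<le> \<eta>"
proof -
  obtain D :: "'a set" where D: "countable D" "\<And>X. open X \<Longrightarrow> X \<noteq> {} \<Longrightarrow> \<exists>d\<in>D. d \<in> X"
    using countable_dense_setE by blast
  have "D \<noteq> {}"
    using D(2)[of UNIV] by auto
  then have rD: "range (from_nat_into D) = D"
    using D(1) by (rule range_from_nat_into)
  define q where "q x = (LEAST n. dist (from_nat_into D n) x < \<eta> / 2)" for x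
  have ex: "\<exists>n. dist (from_nat_into D n) x < \<eta> / 2" for x
  proof -
    obtain d where "d \<in> D" "d \<in> ball x (\<eta> / 2)"
      using D(2)[of "ball x (\<eta> / 2)"] assms by auto
    moreover from this rD obtain n where "d = from_nat_into D n"
      by (metis rangeE)
    ultimately show ?thesis
      by (auto simp: dist_commute)
  qed
  have q: "dist (from_nat_into D (q x)) x < \<eta> / 2" for x
    unfolding q_def by (rule LeastI_ex[OF ex])
  have "q \<in> borel \<rightarrow>\<^sub>M count_space UNIV"
    unfolding q_def by measurable
  moreover have "dist x y \<le> \<eta>" if "q x = q y" for x y
    using dist_triangle_half_r[OF q[of x], of y] q[of y] that by simp
  ultimately show thesis
    using that by blast
qed

context rich_space
begin

text \<open>An exact coupling with \<open>V = (X', _)\<close> need not exist, since \<open>X'\<close> may generate the whole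
  \<open>\<sigma>\<close>-algebra. Instead, on each event that \<open>X'\<close> lies in a given small cell, the conditional law of
  \<open>(X, Z)\<close> given that \<open>X\<close> lies in that cell is realized.\<close>

lemma transfer:
  fixes X X' :: "'w \<Rightarrow> 'a::euclidean_space" and Z :: "'w \<Rightarrow> 'b::euclidean_space"
  assumes [measurable]: "X \<in> borel_measurable P" "X' \<in> borel_measurable P" "Z \<in> borel_measurable P"
    and law: "distr P borel X = distr P borel X'" and "0 < \<eta>"
  obtains V :: "'w \<Rightarrow> 'a \<times> 'b" where "V \<in> borel_measurable P"
    "distr P borel V = distr P borel (\<lambda>\<omega>. (X \<omega>, Z \<omega>))" "AE \<omega> in P. dist (fst (V \<omega>)) (X' \<omega>) \<le> \<eta>"
proof -
  obtain q :: "'a \<Rightarrow> nat" where q [measurable]: "q \<in> borel \<rightarrow>\<^sub>M count_space UNIV"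
    and q_dist: "\<And>x y. q x = q y \<Longrightarrow> dist x y \<le> \<eta>"
    using small_cells[OF \<open>0 < \<eta>\<close>] by blast
  define XZ where "XZ \<omega> = (X \<omega>, Z \<omega>)" for \<omega>
  have XZ [measurable]: "XZ \<in> borel_measurable P"
    unfolding XZ_def[abs_def] by measurable
  define B where "B i = {\<omega>. q (X \<omega>) = i}" for i
  define B' where "B' i = {\<omega>. q (X' \<omega>) = i}" for i
  have "{\<omega>\<in>space P. q (X \<omega>) = i} \<in> sets P" "{\<omega>\<in>space P. q (X' \<omega>) = i} \<in> sets P" for i
    by measurable
  then have [measurable]: "B i \<in> sets P" "B' i \<in> sets P" for i
    by (simp_all add: B_def B'_def)
  \<comment> \<open>Corresponding cells have equal probability, so conditioning on either divides by
    the same number.\<close>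
  have BB': "emeasure P (B' i) = emeasure P (B i)" for i
  proof -
    have [measurable]: "{x. q x = i} \<in> sets borel"
      using measurable_sets[OF q, of "{i}"] by (simp add: vimage_def)
    have "emeasure (distr P borel X') {x. q x = i} = emeasure (distr P borel X) {x. q x = i}"
      by (simp add: law)
    then show ?thesis
      by (simp add: emeasure_distr B_def B'_def vimage_def)
  qed
  have "\<exists>V. V \<in> borel_measurable P \<and>
    (\<forall>C\<in>sets borel. emeasure P (B' i \<inter> V -` C) = emeasure P (B i \<inter> XZ -` C))" for i
  proof (cases "emeasure P (B i) = 0")
    case True
    have "emeasure P (B' i \<inter> (\<lambda>_. undefined) -` C) = 0" "emeasure P (B i \<inter> XZ -` C) = 0" for C
      using True BB'[of i] emeasure_mono[of "B' i \<inter> (\<lambda>_. undefined) -` C" "B' i" P]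
        emeasure_mono[of "B i \<inter> XZ -` C" "B i" P] by auto
    then show ?thesis
      by (intro exI[of _ "\<lambda>_. undefined"]) simp
  next
    case False
    let ?U = "uniform_measure P (B i)" and ?U' = "uniform_measure P (B' i)"
    have U: "prob_space ?U" "prob_space ?U'"
      using False BB'[of i] by (auto intro!: prob_space_uniform_measure)
    have single: "{\<omega>} \<in> sets P" for \<omega>
      using borel_subset by auto
    \<comment> \<open>Conditioning keeps points null, so \<open>realize_law\<close> applies to the
      conditioned space.\<close>
    have null: "emeasure ?U' {\<omega>} = 0" for \<omega>
    proof -
      have "emeasure P (B' i \<inter> {\<omega>}) \<le> emeasure P {\<omega>}"
        using single by (intro emeasure_mono) auto
      then show ?thesis
        using null_singleton[of \<omega>] single by simp
    qed
    have law: "prob_space (distr ?U borel XZ)" "sets (distr ?U borel XZ) = sets borel"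
      using U(1) by (auto intro!: prob_space.prob_space_distr)
    obtain V where V: "V \<in> borel_measurable ?U'" "distr ?U' borel V = distr ?U borel XZ"
      using realize_law[OF U(2) _ null law] borel_subset by auto
    then have [measurable]: "V \<in> borel_measurable P"
      by simp
    have "emeasure P (B' i \<inter> V -` C) = emeasure P (B i \<inter> XZ -` C)" if [measurable]: "C \<in> sets borel" for C
    proof -
      have [measurable]: "V -` C \<in> sets P" "XZ -` C \<in> sets P"
        using measurable_sets[of V P borel C] measurable_sets[of XZ P borel C] by simp_all
      have "emeasure (distr ?U' borel V) C = emeasure (distr ?U borel XZ) C"
        by (simp add: V(2))
      then have eq: "emeasure P (B' i \<inter> V -` C) / emeasure P (B i) = emeasure P (B i \<inter> XZ -` C) / emeasure P (B i)"
        by (simp add: emeasure_distr BB')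
      \<comment> \<open>The probability of the cell is finite and nonzero, so the conditioning can
        be undone by multiplication.\<close>
      have "x = x / emeasure P (B i) * emeasure P (B i)" for x
        using ennreal_divide_self[OF False] emeasure_finite[of "B i"]
        by (simp add: ennreal_divide_times less_top[symmetric] del: emeasure_finite)
      then show ?thesis
        using eq by metis
    qed
    then show ?thesis
      by (intro exI[of _ V]) simp
  qed
  then obtain V where V [measurable]: "\<And>i. V i \<in> borel_measurable P"
    and eq: "\<And>i C. C \<in> sets borel \<Longrightarrow> emeasure P (B' i \<inter> V i -` C) = emeasure P (B i \<inter> XZ -` C)"
    by metis
  \<comment> \<open>The local realizations are pasted along the cells of \<open>X'\<close>.\<close>
  define V' where "V' \<omega> = V (q (X' \<omega>)) \<omega>" for \<omega>
  have V' [measurable]: "V' \<in> borel_measurable P"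
    unfolding V'_def by (rule measurable_compose_countable[where g="\<lambda>\<omega>. q (X' \<omega>)"]) measurable
  have "distr P borel V' = distr P borel XZ"
  proof (rule measure_eqI)
    fix C assume "C \<in> sets (distr P borel V')"
    then have [measurable]: "C \<in> sets borel"
      by simp
    have [measurable]: "V' -` C \<in> sets P" "XZ -` C \<in> sets P"
      using measurable_sets[of V' P borel C] measurable_sets[of XZ P borel C] by simp_all
    have "emeasure (distr P borel V') C = emeasure P (V' -` C)"
      by (simp add: emeasure_distr)
    also have "\<dots> = (\<Sum>i. emeasure P (B' i \<inter> V' -` C))"
      by (subst emeasure_countable_cells[where q="\<lambda>\<omega>. q (X' \<omega>)"]) (simp_all add: B'_def)
    also have "\<dots> = (\<Sum>i. emeasure P (B' i \<inter> V i -` C))"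
      by (intro suminf_cong arg_cong[where f="emeasure P"]) (auto simp: B'_def V'_def)
    also have "\<dots> = (\<Sum>i. emeasure P (B i \<inter> XZ -` C))"
      by (simp add: eq)
    also have "\<dots> = emeasure P (XZ -` C)"
      by (subst (2) emeasure_countable_cells[where q="\<lambda>\<omega>. q (X \<omega>)"]) (simp_all add: B_def)
    also have "\<dots> = emeasure (distr P borel XZ) C"
      by (simp add: emeasure_distr)
    finally show "emeasure (distr P borel V') C = emeasure (distr P borel XZ) C" .
  qed simp
  moreover have "AE \<omega> in P. dist (fst (V' \<omega>)) (X' \<omega>) \<le> \<eta>"
  proof -
    \<comment> \<open>That \<open>X'\<close> is in cell \<open>i\<close> while \<open>V i\<close> is
      not has the same probability as the impossible event that \<open>X\<close> is both in and
      outside the cell.\<close>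
    have "AE \<omega> in P. q (X' \<omega>) = i \<longrightarrow> q (fst (V i \<omega>)) = i" for i
    proof -
      have [measurable]: "(\<lambda>z::'a \<times> 'b. q (fst z)) \<in> borel \<rightarrow>\<^sub>M count_space UNIV"
        by (rule measurable_compose[OF measurable_fst_borel q])
      have C: "{z::'a \<times> 'b. q (fst z) \<noteq> i} \<in> sets borel"
        using measurable_sets[of "\<lambda>z::'a \<times> 'b. q (fst z)" borel "count_space UNIV" "- {i}"]
        by (simp add: vimage_def)
      have "B i \<inter> XZ -` {z. q (fst z) \<noteq> i} = {}"
        by (auto simp: B_def XZ_def)
      then have "emeasure P (B' i \<inter> V i -` {z. q (fst z) \<noteq> i}) = 0"
        using eq[OF C, of i] by simp
      moreover have "B' i \<inter> V i -` {z. q (fst z) \<noteq> i} \<in> sets P"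
        using measurable_sets[OF V C, of i] by (auto intro!: sets.Int)
      ultimately show ?thesis
        by (rule AE_I[rotated]) (auto simp: B'_def)
    qed
    then have "AE \<omega> in P. \<forall>i. q (X' \<omega>) = i \<longrightarrow> q (fst (V i \<omega>)) = i"
      unfolding AE_all_countable by blast
    then show ?thesis
      by eventually_elim (auto simp: V'_def intro: q_dist)
  qed
  ultimately show thesis
    using V' that unfolding XZ_def[abs_def] by blast
qed

end

section \<open>The Lasry--Lions regularization of a Lipschitz functional\<close>

locale lipschitz_lift = rich_space P
  for P :: "'w::{second_countable_topology, t2_space} measure" +
  fixes G :: "'a::euclidean_space measure \<Rightarrow> real" and L :: real
  assumes L_nonneg: "0 \<le> L"
    and G_Lipschitz: "\<mu> \<in> P2 \<Longrightarrow> \<nu> \<in> P2 \<Longrightarrow> \<bar>G \<mu> - G \<nu>\<bar> \<le> L * W2 \<mu> \<nu>"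
begin

lemma lift_Lipschitz:
  assumes "X \<in> L2 P" "Y \<in> L2 P"
  shows "\<bar>lift P G X - lift P G Y\<bar> \<le> L * L2_norm P (\<lambda>\<omega>. X \<omega> - Y \<omega>)"
proof -
  have "\<bar>lift P G X - lift P G Y\<bar> \<le> L * W2 (distr P borel X) (distr P borel Y)"
    unfolding lift_def using assms by (intro G_Lipschitz L2_distr_P2)
  also have "\<dots> \<le> L * L2_norm P (\<lambda>\<omega>. X \<omega> - Y \<omega>)"
    using assms by (intro mult_left_mono W2_le_L2_norm L_nonneg) (auto dest: L2_measurable)
  finally show ?thesis .
qed

lemma lift_shift:
  assumes "X \<in> L2 P" "D \<in> L2 P"
  shows "lift P G (\<lambda>\<omega>. X \<omega> + D \<omega>) \<le> lift P G X + L * L2_norm P D"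
  using lift_Lipschitz[OF L2_add[OF assms] assms(1)] by simp

definition penalized :: "real \<Rightarrow> ('w \<Rightarrow> 'a) \<Rightarrow> ('w \<Rightarrow> 'a) \<Rightarrow> ('w \<Rightarrow> 'a) \<Rightarrow> real" where
  "penalized \<epsilon> X Z Y = lift P G Y - 1 / (2 * \<epsilon>) * (L2_norm P (\<lambda>\<omega>. Z \<omega> - Y \<omega>))\<^sup>2
     + 1 / \<epsilon> * (L2_norm P (\<lambda>\<omega>. Z \<omega> - X \<omega>))\<^sup>2"

lemma lasry_lions_lift_penalized:
  "lasry_lions_lift P G \<epsilon> X = (INF Z\<in>L2 P. SUP Y\<in>L2 P. ereal (penalized \<epsilon> X Z Y))"
  by (simp add: lasry_lions_lift_def penalized_def)

text \<open>Competitors for \<open>X\<close> and \<open>X'\<close> are exchanged through \<open>transfer\<close>. The transferred variables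
  are translated by a small \<open>D\<close>, which makes the two quadratic penalties agree exactly, so that the
  error only enters through the Lipschitz functional.\<close>

lemma lasry_lions_lift_law_mono:
  assumes X: "X \<in> L2 P" and X': "X' \<in> L2 P" and law: "distr P borel X = distr P borel X'"
  shows "lasry_lions_lift P G \<epsilon> X' \<le> lasry_lions_lift P G \<epsilon> X"
  unfolding lasry_lions_lift_penalized
proof (rule INF_greatest)
  fix Z :: "'w \<Rightarrow> 'a" assume Z: "Z \<in> L2 P"
  note [measurable] = L2_measurable[OF X] L2_measurable[OF X'] L2_measurable[OF Z]
  show "(INF Z'\<in>L2 P. SUP Y\<in>L2 P. ereal (penalized \<epsilon> X' Z' Y))
      \<le> (SUP Y\<in>L2 P. ereal (penalized \<epsilon> X Z Y))" (is "?I \<le> ?S")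
  proof (rule ereal_le_epsilon2)
    fix e :: real assume "0 < e"
    \<comment> \<open>Two corrections \<open>D\<close> and \<open>E\<close> of norm at most
      \<open>\<eta>\<close> will each cost \<open>L * \<eta>\<close>; the summand 1 covers
      \<open>L = 0\<close>.\<close>
    define \<eta> where "\<eta> = e / (2 * L + 1)"
    have \<eta>: "0 < \<eta>" "2 * (L * \<eta>) \<le> e"
      using \<open>0 < e\<close> L_nonneg by (auto simp: \<eta>_def field_simps)
    have XZ: "(\<lambda>\<omega>. (X \<omega>, Z \<omega>)) \<in> L2 P"
      by (rule L2_Pair[OF X Z])
    \<comment> \<open>\<open>V\<close> is a copy of \<open>(X, Z)\<close> whose first component lies
      next to \<open>X'\<close>.\<close>
    obtain V where V: "V \<in> borel_measurable P"
      and V_law: "distr P borel V = distr P borel (\<lambda>\<omega>. (X \<omega>, Z \<omega>))"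
      and V_X': "AE \<omega> in P. dist (fst (V \<omega>)) (X' \<omega>) \<le> \<eta>"
      using transfer[OF L2_measurable[OF X] L2_measurable[OF X'] L2_measurable[OF Z] law \<eta>(1)] by blast
    have V2: "V \<in> L2 P"
      using distr_in_P2_iff[OF V] L2_distr_P2[OF XZ] by (simp add: V_law)
    define D where "D \<omega> = X' \<omega> - fst (V \<omega>)" for \<omega>
    have D: "D \<in> L2 P"
      unfolding D_def by (intro L2_diff X' L2_fst V2)
    have D_le: "L2_norm P D \<le> \<eta>"
      using V_X' \<eta>(1) L2_measurable[OF D]
      by (intro L2_norm_le_const) (auto simp: D_def dist_norm norm_minus_commute)
    \<comment> \<open>With the same correction \<open>D\<close> in both variables,
      \<open>Z' - X'\<close> equals the difference of the components of \<open>V\<close>, which has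
      the law of \<open>Z - X\<close>.\<close>
    define Z' where "Z' \<omega> = snd (V \<omega>) + D \<omega>" for \<omega>
    have Z': "Z' \<in> L2 P"
      unfolding Z'_def by (intro L2_add L2_snd V2 D)
    \<comment> \<open>Every reply \<open>Y'\<close> to \<open>Z'\<close> is matched by a reply
      \<open>Y''\<close> to \<open>Z\<close> whose value is smaller by at most
      \<open>e\<close>.\<close>
    have "penalized \<epsilon> X' Z' Y' \<le> ?S + e" if Y': "Y' \<in> L2 P" for Y'
    proof -
      define Y where "Y \<omega> = Y' \<omega> - D \<omega>" for \<omega>
      have Y: "Y \<in> L2 P"
        unfolding Y_def by (intro L2_diff Y' D)
      have VY: "(\<lambda>\<omega>. (V \<omega>, Y \<omega>)) \<in> L2 P"
        by (rule L2_Pair[OF V2 Y])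
      \<comment> \<open>Transfer in the opposite direction: \<open>W\<close> copies
        \<open>(V, Y)\<close>, and its first component lies next to \<open>(X, Z)\<close>.\<close>
      obtain W where W: "W \<in> borel_measurable P"
        and W_law: "distr P borel W = distr P borel (\<lambda>\<omega>. (V \<omega>, Y \<omega>))"
        and W_XZ: "AE \<omega> in P. dist (fst (W \<omega>)) (X \<omega>, Z \<omega>) \<le> \<eta>"
        using transfer[OF V L2_measurable[OF XZ] L2_measurable[OF Y] V_law \<eta>(1)] by blast
      have W2: "W \<in> L2 P"
        using distr_in_P2_iff[OF W] L2_distr_P2[OF VY] by (simp add: W_law)
      define E where "E \<omega> = Z \<omega> - snd (fst (W \<omega>))" for \<omega>
      have E: "E \<in> L2 P"
        unfolding E_def by (intro L2_diff Z L2_snd L2_fst W2)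
      have "AE \<omega> in P. norm (E \<omega>) \<le> \<eta>"
        using W_XZ
      proof eventually_elim
        case (elim \<omega>)
        then show ?case
          using order_trans[OF dist_snd_le[of "fst (W \<omega>)" "(X \<omega>, Z \<omega>)"]]
          by (simp add: E_def dist_norm norm_minus_commute)
      qed
      then have E_le: "L2_norm P E \<le> \<eta>"
        using \<eta>(1) L2_measurable[OF E] by (intro L2_norm_le_const) auto
      \<comment> \<open>The shift by \<open>E\<close> makes \<open>Z - Y''\<close> equal to a
        difference of components of \<open>W\<close>, which has the law of
        \<open>Z' - Y'\<close>.\<close>
      define Y'' where "Y'' \<omega> = snd (W \<omega>) + E \<omega>" for \<omega>
      have sW: "(\<lambda>\<omega>. snd (W \<omega>)) \<in> L2 P"
        by (rule L2_snd[OF W2])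
      have Y'': "Y'' \<in> L2 P"
        unfolding Y''_def by (intro L2_add sW E)
      have W_eq: "L2_norm P (\<lambda>\<omega>. f (W \<omega>)) = L2_norm P (\<lambda>\<omega>. f (V \<omega>, Y \<omega>))"
        if "continuous_on UNIV f" for f :: "('a \<times> 'a) \<times> 'a \<Rightarrow> 'a"
        using L2_norm_distr[OF W borel_measurable_continuous_onI[OF that]]
          L2_norm_distr[OF L2_measurable[OF VY] borel_measurable_continuous_onI[OF that]]
        by (simp add: W_law)
      have V_eq: "L2_norm P (\<lambda>\<omega>. f (V \<omega>)) = L2_norm P (\<lambda>\<omega>. f (X \<omega>, Z \<omega>))"
        if "continuous_on UNIV f" for f :: "'a \<times> 'a \<Rightarrow> 'a"
        using L2_norm_distr[OF V borel_measurable_continuous_onI[OF that]]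
          L2_norm_distr[OF L2_measurable[OF XZ] borel_measurable_continuous_onI[OF that]]
        by (simp add: V_law)
      have "L2_norm P (\<lambda>\<omega>. Z' \<omega> - Y' \<omega>) = L2_norm P (\<lambda>\<omega>. snd (V \<omega>) - Y \<omega>)"
        by (simp add: Z'_def Y_def algebra_simps)
      also have "\<dots> = L2_norm P (\<lambda>\<omega>. snd (fst (W \<omega>)) - snd (W \<omega>))"
        using W_eq[of "\<lambda>z. snd (fst z) - snd z"] by (simp add: continuous_intros)
      also have "\<dots> = L2_norm P (\<lambda>\<omega>. Z \<omega> - Y'' \<omega>)"
        by (simp add: Y''_def E_def)
      finally have ZY: "L2_norm P (\<lambda>\<omega>. Z' \<omega> - Y' \<omega>) = L2_norm P (\<lambda>\<omega>. Z \<omega> - Y'' \<omega>)" .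
      have "L2_norm P (\<lambda>\<omega>. Z' \<omega> - X' \<omega>) = L2_norm P (\<lambda>\<omega>. snd (V \<omega>) - fst (V \<omega>))"
        by (simp add: Z'_def D_def)
      also have "\<dots> = L2_norm P (\<lambda>\<omega>. Z \<omega> - X \<omega>)"
        using V_eq[of "\<lambda>z. snd z - fst z"] by (simp add: continuous_intros)
      finally have ZX: "L2_norm P (\<lambda>\<omega>. Z' \<omega> - X' \<omega>) = L2_norm P (\<lambda>\<omega>. Z \<omega> - X \<omega>)" .
      have "distr P borel (\<lambda>\<omega>. snd (W \<omega>)) = distr (distr P borel W) borel snd"
        using W by (simp add: distr_distr comp_def)
      also have "\<dots> = distr P borel Y"
        using L2_measurable[OF VY] by (simp add: W_law distr_distr comp_def)
      finally have "lift P G (\<lambda>\<omega>. snd (W \<omega>)) = lift P G Y"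
        by (simp add: lift_def)
      moreover have "lift P G Y' \<le> lift P G Y + L * L2_norm P D"
        using lift_shift[OF Y D] by (simp add: Y_def)
      moreover have "lift P G (\<lambda>\<omega>. snd (W \<omega>)) \<le> lift P G Y'' + L * L2_norm P E"
        using lift_Lipschitz[OF sW Y''] L2_norm_minus_commute[of P "\<lambda>\<omega>. snd (W \<omega>)" Y'']
        by (simp add: Y''_def)
      moreover have "L * L2_norm P D \<le> L * \<eta>" "L * L2_norm P E \<le> L * \<eta>"
        using D_le E_le L_nonneg by (auto intro: mult_left_mono)
      ultimately have "lift P G Y' \<le> lift P G Y'' + e"
        using \<eta>(2) by linarith
      then have "penalized \<epsilon> X' Z' Y' \<le> penalized \<epsilon> X Z Y'' + e"
        by (simp add: penalized_def ZX ZY)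
      then have "ereal (penalized \<epsilon> X' Z' Y') \<le> ereal (penalized \<epsilon> X Z Y'') + ereal e"
        by simp
      also have "\<dots> \<le> ?S + ereal e"
        by (intro add_right_mono SUP_upper Y'')
      finally show ?thesis .
    qed
    then have "(SUP Y'\<in>L2 P. ereal (penalized \<epsilon> X' Z' Y')) \<le> ?S + e"
      by (intro SUP_least) auto
    then show "?I \<le> ?S + ereal e"
      by (rule INF_lower2[OF Z'])
  qed
qed

lemma lasry_lions_lift_law_cong:
  assumes "X \<in> L2 P" "X' \<in> L2 P" "distr P borel X = distr P borel X'"
  shows "lasry_lions_lift P G \<epsilon> X = lasry_lions_lift P G \<epsilon> X'"
  using lasry_lions_lift_law_mono[OF assms] lasry_lions_lift_law_mono[OF assms(2,1) assms(3)[symmetric]]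
  by (rule antisym[rotated])

text \<open>The definition selects some representative of the law; law invariance allows the given
  \<open>X\<close> instead.\<close>

lemma lasry_lions_distr:
  assumes "X \<in> L2 P"
  shows "lasry_lions P G \<epsilon> (distr P borel X) = real_of_ereal (lasry_lions_lift P G \<epsilon> X)"
proof -
  let ?X = "SOME X'. X' \<in> L2 P \<and> distr P borel X' = distr P borel X"
  have "?X \<in> L2 P \<and> distr P borel ?X = distr P borel X"
    by (rule someI[of _ X]) (simp add: assms)
  then show ?thesis
    unfolding lasry_lions_def using lasry_lions_lift_law_cong[OF assms, of ?X] by simp
qed

text \<open>With \<open>Z = X\<close> one penalty vanishes, and the other dominates the Lipschitz
  gain up to a constant, by completing the square.\<close>

lemma lasry_lions_lift_upper:
  assumes "0 < \<epsilon>" "X \<in> L2 P"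
  shows "lasry_lions_lift P G \<epsilon> X \<le> ereal (lift P G X + \<epsilon> * L\<^sup>2 / 2)"
proof -
  have "penalized \<epsilon> X X Y \<le> lift P G X + \<epsilon> * L\<^sup>2 / 2" if Y: "Y \<in> L2 P" for Y
  proof -
    define b where "b = L2_norm P (\<lambda>\<omega>. X \<omega> - Y \<omega>)"
    have "lift P G Y \<le> lift P G X + L * b"
      using lift_Lipschitz[OF assms(2) Y] by (simp add: b_def)
    moreover have "L * b \<le> 1 / (2 * \<epsilon>) * b\<^sup>2 + \<epsilon> * L\<^sup>2 / 2"
    proof -
      have "0 \<le> (b - \<epsilon> * L)\<^sup>2 / (2 * \<epsilon>)"
        using assms(1) by simp
      also have "\<dots> = 1 / (2 * \<epsilon>) * b\<^sup>2 + \<epsilon> * L\<^sup>2 / 2 - L * b"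
        using assms(1) by (simp add: power2_diff field_simps power2_eq_square)
      finally show ?thesis
        by simp
    qed
    ultimately show ?thesis
      by (simp add: penalized_def b_def L2_norm_def)
  qed
  then have "(SUP Y\<in>L2 P. ereal (penalized \<epsilon> X X Y)) \<le> ereal (lift P G X + \<epsilon> * L\<^sup>2 / 2)"
    by (intro SUP_least) auto
  then show ?thesis
    unfolding lasry_lions_lift_penalized by (rule INF_lower2[OF assms(2)])
qed

text \<open>The reply \<open>Y = Z\<close> removes the penalty with the negative sign; completing
  the square with the remaining coefficient \<open>1 / \<epsilon>\<close> gives the
  constant.\<close>

lemma lasry_lions_lift_lower:
  assumes "0 < \<epsilon>" "X \<in> L2 P"
  shows "ereal (lift P G X - \<epsilon> * L\<^sup>2 / 4) \<le> lasry_lions_lift P G \<epsilon> X"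
  unfolding lasry_lions_lift_penalized
proof (rule INF_greatest)
  fix Z :: "'w \<Rightarrow> 'a" assume Z: "Z \<in> L2 P"
  define a where "a = L2_norm P (\<lambda>\<omega>. Z \<omega> - X \<omega>)"
  have "lift P G X \<le> lift P G Z + L * a"
    using lift_Lipschitz[OF Z assms(2)] by (simp add: a_def)
  moreover have "L * a \<le> 1 / \<epsilon> * a\<^sup>2 + \<epsilon> * L\<^sup>2 / 4"
  proof -
    have "0 \<le> (2 * a - \<epsilon> * L)\<^sup>2 / (4 * \<epsilon>)"
      using assms(1) by simp
    also have "\<dots> = 1 / \<epsilon> * a\<^sup>2 + \<epsilon> * L\<^sup>2 / 4 - L * a"
      using assms(1) by (simp add: power2_diff field_simps power2_eq_square)
    finally show ?thesis
      by simp
  qed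
  ultimately have "lift P G X - \<epsilon> * L\<^sup>2 / 4 \<le> penalized \<epsilon> X Z Z"
    by (simp add: penalized_def a_def L2_norm_def)
  then show "ereal (lift P G X - \<epsilon> * L\<^sup>2 / 4) \<le> (SUP Y\<in>L2 P. ereal (penalized \<epsilon> X Z Y))"
    by (intro SUP_upper2[OF Z]) simp
qed

text \<open>The two bounds make the inf-sup finite, so \<open>real_of_ereal\<close> loses
  nothing.\<close>

lemma ereal_lasry_lions_distr:
  assumes "0 < \<epsilon>" "X \<in> L2 P"
  shows "ereal (lasry_lions P G \<epsilon> (distr P borel X)) = lasry_lions_lift P G \<epsilon> X"
proof -
  have "\<bar>lasry_lions_lift P G \<epsilon> X\<bar> \<noteq> \<infinity>"
    using lasry_lions_lift_lower[OF assms] lasry_lions_lift_upper[OF assms] by auto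
  then show ?thesis
    by (simp add: lasry_lions_distr[OF assms(2)] ereal_real)
qed

lemma lasry_lions_near_infimum:
  assumes "0 < \<epsilon>" "X \<in> L2 P" "0 < s"
  obtains Z where "Z \<in> L2 P"
    "\<And>Y. Y \<in> L2 P \<Longrightarrow> penalized \<epsilon> X Z Y \<le> lasry_lions P G \<epsilon> (distr P borel X) + s"
proof -
  have "lasry_lions_lift P G \<epsilon> X < ereal (lasry_lions P G \<epsilon> (distr P borel X) + s)"
    using assms by (simp flip: ereal_lasry_lions_distr)
  then obtain Z where Z: "Z \<in> L2 P"
    "(SUP Y\<in>L2 P. ereal (penalized \<epsilon> X Z Y)) < ereal (lasry_lions P G \<epsilon> (distr P borel X) + s)"
    unfolding lasry_lions_lift_penalized INF_less_iff by blast
  show thesis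
  proof (rule that[OF Z(1)])
    fix Y :: "'w \<Rightarrow> 'a" assume "Y \<in> L2 P"
    then have "ereal (penalized \<epsilon> X Z Y) \<le> (SUP Y\<in>L2 P. ereal (penalized \<epsilon> X Z Y))"
      by (rule SUP_upper)
    from order_trans[OF this less_imp_le[OF Z(2)]]
    show "penalized \<epsilon> X Z Y \<le> lasry_lions P G \<epsilon> (distr P borel X) + s"
      by simp
  qed
qed

text \<open>If a nearly optimal reply does worse than \<open>Z\<close>, then \<open>Z\<close> itself
  is nearly optimal. The extra comparison with \<open>Z\<close> later bounds \<open>Z - Y\<close>
  without any contribution of \<open>s\<close>.\<close>

lemma lasry_lions_near_supremum:
  assumes "0 < \<epsilon>" "X \<in> L2 P" "0 < s" "Z \<in> L2 P"
  obtains Y where "Y \<in> L2 P"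
    "lasry_lions P G \<epsilon> (distr P borel X) \<le> penalized \<epsilon> X Z Y + s" "penalized \<epsilon> X Z Z \<le> penalized \<epsilon> X Z Y"
proof -
  have "ereal (lasry_lions P G \<epsilon> (distr P borel X) - s) < lasry_lions_lift P G \<epsilon> X"
    using assms by (simp flip: ereal_lasry_lions_distr)
  also have "\<dots> \<le> (SUP Y\<in>L2 P. ereal (penalized \<epsilon> X Z Y))"
    unfolding lasry_lions_lift_penalized by (rule INF_lower[OF assms(4)])
  finally obtain Y where Y: "Y \<in> L2 P" "lasry_lions P G \<epsilon> (distr P borel X) - s < penalized \<epsilon> X Z Y"
    unfolding less_SUP_iff by auto
  show thesis
  proof (cases "penalized \<epsilon> X Z Z \<le> penalized \<epsilon> X Z Y")
    case True
    then show thesis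
      using that[of Y] Y by simp
  next
    case False
    then show thesis
      using that[of Z] Y assms(4) by simp
  qed
qed

lemma penalized_shift:
  "penalized \<epsilon> (\<lambda>\<omega>. X \<omega> + W \<omega>) (\<lambda>\<omega>. Z \<omega> + W \<omega>) (\<lambda>\<omega>. Y \<omega> + W \<omega>)
     = penalized \<epsilon> X Z Y + (lift P G (\<lambda>\<omega>. Y \<omega> + W \<omega>) - lift P G Y)"
  by (simp add: penalized_def)

text \<open>Translating \<open>X\<close>, \<open>Z\<close> and \<open>Y\<close> simultaneously by \<open>W\<close> leaves the penalties unchanged.\<close>

lemma lasry_lions_increment:
  assumes \<epsilon>: "0 < \<epsilon>" and X: "X \<in> L2 P" and W: "W \<in> L2 P" and s: "0 < s" "s \<le> \<epsilon>"
  obtains Y where "Y \<in> L2 P" "L2_norm P (\<lambda>\<omega>. Y \<omega> - X \<omega>) \<le> \<epsilon> * (4 * L + 1)"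
    "lasry_lions P G \<epsilon> (distr P borel (\<lambda>\<omega>. X \<omega> + W \<omega>)) - lasry_lions P G \<epsilon> (distr P borel X)
       \<le> lift P G (\<lambda>\<omega>. Y \<omega> + W \<omega>) - lift P G Y + 2 * s"
proof -
  let ?E = "\<lambda>X. lasry_lions P G \<epsilon> (distr P borel X)"
  obtain Z where Z: "Z \<in> L2 P" and Z_opt: "\<And>Y. Y \<in> L2 P \<Longrightarrow> penalized \<epsilon> X Z Y \<le> ?E X + s"
    using lasry_lions_near_infimum[OF \<epsilon> X s(1)] by blast
  obtain Y' where Y': "Y' \<in> L2 P"
    "?E (\<lambda>\<omega>. X \<omega> + W \<omega>) \<le> penalized \<epsilon> (\<lambda>\<omega>. X \<omega> + W \<omega>) (\<lambda>\<omega>. Z \<omega> + W \<omega>) Y' + s"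
    "penalized \<epsilon> (\<lambda>\<omega>. X \<omega> + W \<omega>) (\<lambda>\<omega>. Z \<omega> + W \<omega>) (\<lambda>\<omega>. Z \<omega> + W \<omega>)
      \<le> penalized \<epsilon> (\<lambda>\<omega>. X \<omega> + W \<omega>) (\<lambda>\<omega>. Z \<omega> + W \<omega>) Y'"
    using lasry_lions_near_supremum[OF \<epsilon> L2_add[OF X W] s(1) L2_add[OF Z W]] by blast
  define Y where "Y \<omega> = Y' \<omega> - W \<omega>" for \<omega>
  have Y: "Y \<in> L2 P"
    unfolding Y_def by (intro L2_diff Y' W)
  have Y'_eq: "Y' = (\<lambda>\<omega>. Y \<omega> + W \<omega>)"
    by (simp add: Y_def)
  have YW: "(\<lambda>\<omega>. Y \<omega> + W \<omega>) \<in> L2 P" and ZW: "(\<lambda>\<omega>. Z \<omega> + W \<omega>) \<in> L2 P"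
    using Y Z W by (auto intro: L2_add)
  define a where "a = L2_norm P (\<lambda>\<omega>. Z \<omega> - X \<omega>)"
  define b where "b = L2_norm P (\<lambda>\<omega>. Z \<omega> - Y \<omega>)"
  have ab: "0 \<le> a" "0 \<le> b"
    by (simp_all add: a_def b_def)
  \<comment> \<open>Testing \<open>Z_opt\<close> with \<open>Y = Z\<close> and using the upper bound
    on the inf-sup gives \<open>a\<^sup>2 \<le> \<epsilon> * (L * a + \<epsilon> * L\<^sup>2 / 2 +
    \<epsilon>)\<close>, which fails beyond this threshold.\<close>
  have "a \<le> \<epsilon> * (2 * L + 1)"
  proof (rule ccontr)
    assume "\<not> ?thesis"
    then have less: "\<epsilon> * (2 * L + 1) < a"
      by simp
    have "ereal (?E X) \<le> ereal (lift P G X + \<epsilon> * L\<^sup>2 / 2)"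
      using lasry_lions_lift_upper[OF \<epsilon> X] by (simp only: ereal_lasry_lions_distr[OF \<epsilon> X])
    then have "?E X \<le> lift P G X + \<epsilon> * L\<^sup>2 / 2"
      by simp
    moreover have "lift P G X \<le> lift P G Z + L * a"
      using lift_Lipschitz[OF Z X] by (simp add: a_def)
    moreover have "lift P G Z + 1 / \<epsilon> * a\<^sup>2 \<le> ?E X + s"
      using Z_opt[OF Z] by (simp add: penalized_def a_def L2_norm_def)
    ultimately have "1 / \<epsilon> * a\<^sup>2 \<le> L * a + \<epsilon> * L\<^sup>2 / 2 + \<epsilon>"
      using s by linarith
    then have "a\<^sup>2 \<le> \<epsilon> * (L * a + \<epsilon> * L\<^sup>2 / 2 + \<epsilon>)"
      using \<epsilon> by (simp add: field_simps)
    moreover have "\<epsilon> * (2 * L + 1) * a \<le> a * a"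
      using less ab by (intro mult_right_mono) auto
    moreover have "\<epsilon> * (L + 1) * (\<epsilon> * (2 * L + 1)) < \<epsilon> * (L + 1) * a"
      using less \<epsilon> L_nonneg by (intro mult_strict_left_mono) auto
    ultimately have "\<epsilon> * \<epsilon> * ((L + 1) * (2 * L + 1)) < \<epsilon> * \<epsilon> * (L\<^sup>2 / 2 + 1)"
      by (simp add: algebra_simps power2_eq_square)
    then have "(L + 1) * (2 * L + 1) < L\<^sup>2 / 2 + 1"
      by (rule mult_left_less_imp_less) simp
    moreover have "0 \<le> L * L"
      by simp
    ultimately show False
      using L_nonneg by (simp add: algebra_simps power2_eq_square)
  qed
  \<comment> \<open>In the translated problem \<open>Y'\<close> does at least as well as
    \<open>Z + W\<close>, so the Lipschitz gain \<open>L * b\<close> must pay for the penalty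
    \<open>b\<^sup>2 / (2 * \<epsilon>)\<close>.\<close>
  moreover have "b \<le> 2 * \<epsilon> * L"
  proof (rule ccontr)
    assume "\<not> ?thesis"
    then have less: "2 * \<epsilon> * L < b"
      by simp
    have "penalized \<epsilon> X Z Z + (lift P G (\<lambda>\<omega>. Z \<omega> + W \<omega>) - lift P G Z)
        \<le> penalized \<epsilon> X Z Y + (lift P G (\<lambda>\<omega>. Y \<omega> + W \<omega>) - lift P G Y)"
      using Y'(3) unfolding Y'_eq penalized_shift .
    moreover have "lift P G (\<lambda>\<omega>. Y \<omega> + W \<omega>) \<le> lift P G (\<lambda>\<omega>. Z \<omega> + W \<omega>) + L * b"
      using lift_Lipschitz[OF ZW YW] by (simp add: b_def)
    ultimately have "1 / (2 * \<epsilon>) * b\<^sup>2 \<le> L * b"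
      by (simp add: penalized_def b_def L2_norm_def)
    then have "b * b \<le> (2 * \<epsilon> * L) * b"
      using \<epsilon> by (simp add: field_simps power2_eq_square)
    moreover have "0 < b"
      using less \<epsilon> L_nonneg by (meson le_less_trans mult_nonneg_nonneg less_imp_le zero_le_numeral)
    ultimately show False
      using less by simp
  qed
  moreover have "L2_norm P (\<lambda>\<omega>. Y \<omega> - X \<omega>) \<le> b + a"
    using L2_norm_triangle_diff[OF Y Z X] by (simp add: a_def b_def L2_norm_minus_commute[of P Y Z])
  ultimately have "L2_norm P (\<lambda>\<omega>. Y \<omega> - X \<omega>) \<le> \<epsilon> * (4 * L + 1)"
    by (simp add: algebra_simps)
  \<comment> \<open>One \<open>s\<close> comes from the choice of \<open>Z\<close>, the other from
    that of \<open>Y'\<close>.\<close>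
  moreover have "?E (\<lambda>\<omega>. X \<omega> + W \<omega>) - ?E X \<le> lift P G (\<lambda>\<omega>. Y \<omega> + W \<omega>) - lift P G Y + 2 * s"
    using Y'(2) Z_opt[OF Y] unfolding Y'_eq penalized_shift by linarith
  ultimately show thesis
    using that Y by blast
qed

lemma lasry_lions_Lipschitz:
  assumes "0 < \<epsilon>" "X \<in> L2 P" "X' \<in> L2 P"
  shows "lasry_lions P G \<epsilon> (distr P borel X') - lasry_lions P G \<epsilon> (distr P borel X)
    \<le> L * L2_norm P (\<lambda>\<omega>. X' \<omega> - X \<omega>)"
proof (rule field_le_epsilon)
  fix e :: real assume "0 < e"
  define s where "s = min \<epsilon> (e / 2)"
  have s: "0 < s" "s \<le> \<epsilon>" "2 * s \<le> e"
    using \<open>0 < e\<close> assms(1) by (auto simp: s_def)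
  have D: "(\<lambda>\<omega>. X' \<omega> - X \<omega>) \<in> L2 P"
    by (rule L2_diff[OF assms(3,2)])
  obtain Y where Y: "Y \<in> L2 P"
    "lasry_lions P G \<epsilon> (distr P borel (\<lambda>\<omega>. X \<omega> + (X' \<omega> - X \<omega>))) - lasry_lions P G \<epsilon> (distr P borel X)
       \<le> lift P G (\<lambda>\<omega>. Y \<omega> + (X' \<omega> - X \<omega>)) - lift P G Y + 2 * s"
    using lasry_lions_increment[OF assms(1,2) D s(1,2)] by blast
  moreover have "lift P G (\<lambda>\<omega>. Y \<omega> + (X' \<omega> - X \<omega>)) \<le> lift P G Y + L * L2_norm P (\<lambda>\<omega>. X' \<omega> - X \<omega>)"
    by (rule lift_shift[OF Y(1) D])
  ultimately show "lasry_lions P G \<epsilon> (distr P borel X') - lasry_lions P G \<epsilon> (distr P borel X)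
    \<le> L * L2_norm P (\<lambda>\<omega>. X' \<omega> - X \<omega>) + e"
    using s(3) by simp
qed

end

section \<open>Disintegration\<close>

lemma measurable_Pair_kernel:
  fixes \<kappa> :: "'b \<Rightarrow> 'a::euclidean_space measure" and z :: "'c::euclidean_space"
  assumes "\<kappa> \<in> M \<rightarrow>\<^sub>M subprob_algebra borel" "x \<in> space M"
  shows "Pair z \<in> \<kappa> x \<rightarrow>\<^sub>M borel"
  using sets_kernel[OF assms]
  by (simp add: borel_measurable_continuous_onI continuous_intros cong: measurable_cong_sets)

text \<open>The law \<open>\<kappa> x\<close> is placed on the fibre over \<open>x\<close>, which
  lets \<open>\<gamma>\<close> be written as a composition of \<open>\<mu>\<close> with a kernel
  into the product space.\<close>

lemma measurable_distr_Pair_kernel: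
  fixes \<mu> :: "'a::euclidean_space measure"
  assumes \<kappa>: "\<kappa> \<in> \<mu> \<rightarrow>\<^sub>M subprob_algebra borel" and sets: "sets \<mu> = sets borel"
  shows "(\<lambda>x. distr (\<kappa> x) borel (Pair x :: 'a \<Rightarrow> 'a \<times> 'a)) \<in> \<mu> \<rightarrow>\<^sub>M subprob_algebra borel"
proof -
  have "(\<lambda>(x, y). (x, y)) \<in> \<mu> \<Otimes>\<^sub>M borel \<rightarrow>\<^sub>M (borel :: ('a \<times> 'a) measure)"
    using sets by (simp add: borel_prod[symmetric] measurable_ident_sets cong: sets_pair_measure_cong)
  then show ?thesis
    by (intro measurable_distr2[OF _ \<kappa>]) (simp add: case_prod_eta)
qed

lemma measurable_kernel_integral:
  fixes \<mu> :: "'a::euclidean_space measure" and f :: "'a \<times> 'a \<Rightarrow> real"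
  assumes \<kappa>: "\<kappa> \<in> \<mu> \<rightarrow>\<^sub>M subprob_algebra borel" and sets: "sets \<mu> = sets borel"
    and f: "f \<in> borel_measurable borel"
  shows "(\<lambda>x. LINT y|\<kappa> x. f (x, y)) \<in> borel_measurable \<mu>"
proof -
  have "(\<lambda>x. integral\<^sup>L (distr (\<kappa> x) borel (Pair x)) f) \<in> borel_measurable \<mu>"
    by (rule measurable_compose[OF measurable_distr_Pair_kernel[OF \<kappa> sets]
          integral_measurable_subprob_algebra[OF f]])
  then show ?thesis
    by (rule measurable_cong[THEN iffD1, rotated])
       (rule integral_distr[OF measurable_Pair_kernel[OF \<kappa>] f])
qed

lemma disintegration_nn_integral:
  fixes \<gamma> :: "('a::euclidean_space \<times> 'a) measure"
  assumes dis: "disintegration \<gamma> \<mu> \<kappa>" and sets: "sets \<gamma> = sets borel" "sets \<mu> = sets borel"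
    and f: "f \<in> borel_measurable borel"
  shows "(\<integral>\<^sup>+z. f z \<partial>\<gamma>) = (\<integral>\<^sup>+x. \<integral>\<^sup>+y. f (x, y) \<partial>\<kappa> x \<partial>\<mu>)"
proof -
  have \<kappa>[measurable]: "\<kappa> \<in> \<mu> \<rightarrow>\<^sub>M subprob_algebra borel"
    using dis by (auto simp: disintegration_def intro: measurable_prob_algebraD)
  define N where "N x = distr (\<kappa> x) borel (Pair x)" for x
  note Pair = measurable_Pair_kernel[OF \<kappa>]
  have N [measurable]: "N \<in> \<mu> \<rightarrow>\<^sub>M subprob_algebra borel"
    unfolding N_def[abs_def] by (rule measurable_distr_Pair_kernel[OF \<kappa> sets(2)])
  have ne: "space \<mu> \<noteq> {}"
    using sets_eq_imp_space_eq[OF sets(2)] by simp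
  have "\<gamma> = \<mu> \<bind> N"
  proof (rule measure_eqI)
    show "sets \<gamma> = sets (\<mu> \<bind> N)"
      using sets(1) by (simp add: sets_bind[OF sets_kernel[OF N] ne])
    fix C assume "C \<in> sets \<gamma>"
    then have C: "C \<in> sets borel"
      by (simp add: sets)
    have "emeasure \<gamma> C = (\<integral>\<^sup>+x. emeasure (\<kappa> x) {y. (x, y) \<in> C} \<partial>\<mu>)"
      using dis C by (simp add: disintegration_def)
    also have "\<dots> = (\<integral>\<^sup>+x. emeasure (N x) C \<partial>\<mu>)"
    proof (rule nn_integral_cong)
      fix x assume x: "x \<in> space \<mu>"
      then show "emeasure (\<kappa> x) {y. (x, y) \<in> C} = emeasure (N x) C"
        using sets_eq_imp_space_eq[OF sets_kernel[OF \<kappa> x]]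
        by (simp add: N_def emeasure_distr[OF Pair[OF x] C] vimage_def)
    qed
    also have "\<dots> = emeasure (\<mu> \<bind> N) C"
      by (rule emeasure_bind[OF ne N C, symmetric])
    finally show "emeasure \<gamma> C = emeasure (\<mu> \<bind> N) C" .
  qed
  then have "(\<integral>\<^sup>+z. f z \<partial>\<gamma>) = (\<integral>\<^sup>+x. \<integral>\<^sup>+z. f z \<partial>N x \<partial>\<mu>)"
    by (simp add: nn_integral_bind[OF f N])
  also have "\<dots> = (\<integral>\<^sup>+x. \<integral>\<^sup>+y. f (x, y) \<partial>\<kappa> x \<partial>\<mu>)"
    by (intro nn_integral_cong) (simp add: N_def nn_integral_distr[OF Pair] f)
  finally show ?thesis .
qed

text \<open>The nonnegative version is applied to the positive and negative parts; their integrals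
  are finite, so the fibre integrals are finite almost everywhere.\<close>

lemma disintegration_integral:
  fixes \<gamma> :: "('a::euclidean_space \<times> 'a) measure" and f :: "'a \<times> 'a \<Rightarrow> real"
  assumes dis: "disintegration \<gamma> \<mu> \<kappa>" and sets: "sets \<gamma> = sets borel" "sets \<mu> = sets borel"
    and f: "integrable \<gamma> f"
  shows "AE x in \<mu>. integrable (\<kappa> x) (\<lambda>y. f (x, y))"
    and "integral\<^sup>L \<gamma> f = (LINT x|\<mu>. LINT y|\<kappa> x. f (x, y))"
proof -
  have fm [measurable]: "f \<in> borel_measurable borel"
    using borel_measurable_integrable[OF f] sets(1) by (simp cong: measurable_cong_sets)
  have \<kappa>[measurable]: "\<kappa> \<in> \<mu> \<rightarrow>\<^sub>M subprob_algebra borel"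
    using dis by (auto simp: disintegration_def intro: measurable_prob_algebraD)
  have f_pair: "(\<lambda>(x, y). f (x, y)) \<in> borel_measurable (\<mu> \<Otimes>\<^sub>M borel)"
    using fm sets(2) by (simp add: case_prod_eta borel_prod[symmetric] cong: measurable_cong_sets sets_pair_measure_cong)
  have fx: "(\<lambda>y. f (x, y)) \<in> borel_measurable (\<kappa> x)" if "x \<in> space \<mu>" for x
  proof -
    have "(\<lambda>y. f (x, y)) \<in> borel_measurable borel"
      by (rule measurable_compose[OF _ fm]) (intro borel_measurable_continuous_onI continuous_intros)
    then show ?thesis
      using sets_kernel[OF \<kappa> that] by (simp cong: measurable_cong_sets)
  qed
  have meas: "(\<lambda>x. \<integral>\<^sup>+y. ennreal (g (f (x, y))) \<partial>\<kappa> x) \<in> borel_measurable \<mu>"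
    if [measurable]: "g \<in> borel_measurable borel" for g
    using f_pair by (intro nn_integral_measurable_subprob_algebra2[OF _ \<kappa>])
      (auto simp: case_prod_unfold intro!: measurable_compose[OF _ measurable_ennreal] measurable_compose[OF _ that])
  define a where "a x = (\<integral>\<^sup>+y. ennreal (f (x, y)) \<partial>\<kappa> x)" for x
  define b where "b x = (\<integral>\<^sup>+y. ennreal (- f (x, y)) \<partial>\<kappa> x)" for x
  have ab [measurable]: "a \<in> borel_measurable \<mu>" "b \<in> borel_measurable \<mu>"
    unfolding a_def[abs_def] b_def[abs_def] using meas[of "\<lambda>x. x"] meas[of "\<lambda>x. - x"] by simp_all
  have \<gamma>_a: "(\<integral>\<^sup>+z. ennreal (f z) \<partial>\<gamma>) = (\<integral>\<^sup>+x. a x \<partial>\<mu>)"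
    unfolding a_def by (rule disintegration_nn_integral[OF dis sets]) measurable
  have \<gamma>_b: "(\<integral>\<^sup>+z. ennreal (- f z) \<partial>\<gamma>) = (\<integral>\<^sup>+x. b x \<partial>\<mu>)"
    unfolding b_def by (rule disintegration_nn_integral[OF dis sets]) measurable
  have fin: "(\<integral>\<^sup>+x. a x \<partial>\<mu>) \<noteq> \<infinity>" "(\<integral>\<^sup>+x. b x \<partial>\<mu>) \<noteq> \<infinity>"
    using f by (simp_all add: real_integrable_def flip: \<gamma>_a \<gamma>_b)
  have fin_AE: "AE x in \<mu>. a x \<noteq> \<infinity>" "AE x in \<mu>. b x \<noteq> \<infinity>"
    by (rule nn_integral_PInf_AE[OF ab(1) fin(1)], rule nn_integral_PInf_AE[OF ab(2) fin(2)])
  have int_iff: "integrable (\<kappa> x) (\<lambda>y. f (x, y)) \<longleftrightarrow> a x \<noteq> \<infinity> \<and> b x \<noteq> \<infinity>" if "x \<in> space \<mu>" for x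
    using fx[OF that] by (simp add: real_integrable_def a_def b_def)
  show int: "AE x in \<mu>. integrable (\<kappa> x) (\<lambda>y. f (x, y))"
    using fin_AE AE_space by eventually_elim (simp add: int_iff)
  \<comment> \<open>Since \<open>h\<close> is finite almost everywhere, its extended integral can be
    read as a Bochner integral.\<close>
  have enn: "integrable \<mu> (\<lambda>x. enn2real (h x))" "(LINT x|\<mu>. enn2real (h x)) = enn2real (\<integral>\<^sup>+x. h x \<partial>\<mu>)"
    if [measurable]: "h \<in> borel_measurable \<mu>" and "(\<integral>\<^sup>+x. h x \<partial>\<mu>) \<noteq> \<infinity>" "AE x in \<mu>. h x \<noteq> \<infinity>" for h
  proof -
    have eq: "(\<integral>\<^sup>+x. ennreal (enn2real (h x)) \<partial>\<mu>) = (\<integral>\<^sup>+x. h x \<partial>\<mu>)"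
      using that(3) by (intro nn_integral_cong_AE) (auto simp: less_top)
    show "integrable \<mu> (\<lambda>x. enn2real (h x))"
      using that(2) eq by (intro integrableI_nonneg) (auto simp: less_top)
    show "(LINT x|\<mu>. enn2real (h x)) = enn2real (\<integral>\<^sup>+x. h x \<partial>\<mu>)"
      using eq by (subst integral_eq_nn_integral) auto
  qed
  have "integral\<^sup>L \<gamma> f = enn2real (\<integral>\<^sup>+x. a x \<partial>\<mu>) - enn2real (\<integral>\<^sup>+x. b x \<partial>\<mu>)"
    by (simp add: real_lebesgue_integral_def[OF f] \<gamma>_a \<gamma>_b)
  also have "\<dots> = (LINT x|\<mu>. enn2real (a x) - enn2real (b x))"
    using enn[OF ab(1) fin(1) fin_AE(1)] enn[OF ab(2) fin(2) fin_AE(2)] by simp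
  also have "\<dots> = (LINT x|\<mu>. LINT y|\<kappa> x. f (x, y))"
  proof (rule integral_cong_AE)
    show "(\<lambda>x. LINT y|\<kappa> x. f (x, y)) \<in> borel_measurable \<mu>"
      by (rule measurable_kernel_integral[OF \<kappa> sets(2) fm])
    show "AE x in \<mu>. enn2real (a x) - enn2real (b x) = (LINT y|\<kappa> x. f (x, y))"
      using int by eventually_elim (simp add: real_lebesgue_integral_def a_def b_def)
  qed measurable
  finally show "integral\<^sup>L \<gamma> f = (LINT x|\<mu>. LINT y|\<kappa> x. f (x, y))" .
qed

text \<open>Jensen's inequality for the squared norm: the variance around the mean \<open>v\<close>
  is nonnegative.\<close>

lemma (in prob_space) norm_integral_power2_le:
  fixes f :: "'a \<Rightarrow> 'b::euclidean_space"
  assumes f: "f \<in> L2 M"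
  shows "integrable M f" "(norm (LINT x|M. f x))\<^sup>2 \<le> (LINT x|M. (norm (f x))\<^sup>2)"
proof -
  show int: "integrable M f"
  proof (rule Bochner_Integration.integrable_bound)
    show "integrable M (\<lambda>x. 1 + (norm (f x))\<^sup>2)"
      using f by (auto simp: L2_def)
    have "norm (f x) \<le> 1 + (norm (f x))\<^sup>2" for x
      using sum_squares_bound[of 1 "norm (f x)"] norm_ge_zero[of "f x"] unfolding power_one by linarith
    then show "AE x in M. norm (f x) \<le> norm (1 + (norm (f x))\<^sup>2)"
      by (auto intro: order_trans)
  qed (use f in measurable)
  define v where "v = (LINT x|M. f x)"
  have "0 \<le> (LINT x|M. (norm (f x - v))\<^sup>2)"
    by (intro integral_nonneg_AE) simp
  also have "\<dots> = (LINT x|M. (norm (f x))\<^sup>2 - 2 * (f x \<bullet> v) + (norm v)\<^sup>2)"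
    by (intro Bochner_Integration.integral_cong) (simp_all add: power2_norm_eq_inner inner_diff inner_commute)
  also have "\<dots> = (LINT x|M. (norm (f x))\<^sup>2) - 2 * (v \<bullet> v) + (norm v)\<^sup>2"
    using L2_integrable[OF f] int by (simp add: v_def prob_space)
  finally show "(norm (LINT x|M. f x))\<^sup>2 \<le> (LINT x|M. (norm (f x))\<^sup>2)"
    by (simp add: v_def power2_norm_eq_inner)
qed

text \<open>Jensen's inequality on each fibre is integrated over \<open>\<mu>\<close>.
  Extended-valued integrals are used because square integrability of the pullback is itself a
  conclusion; a fibre with infinite integral is trivial.\<close>

lemma pullback_L2:
  fixes \<gamma> :: "('a::euclidean_space \<times> 'a) measure"
  assumes dis: "disintegration \<gamma> \<mu> \<kappa>" and \<gamma>: "\<gamma> \<in> couplings \<mu> \<nu>" and \<beta>: "\<beta> \<in> L2 \<nu>"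
  shows "pullback \<kappa> \<beta> \<in> L2 \<mu>" "L2_norm \<mu> (pullback \<kappa> \<beta>) \<le> L2_norm \<nu> \<beta>"
proof -
  have sets: "sets \<gamma> = sets borel" "sets \<mu> = sets borel" "sets \<nu> = sets borel"
    using \<gamma> by (auto simp: couplings_def)
  have [measurable]: "\<beta> \<in> borel_measurable borel"
    using L2_measurable[OF \<beta>] sets(3) by (simp cong: measurable_cong_sets)
  have \<kappa>: "\<kappa> \<in> \<mu> \<rightarrow>\<^sub>M subprob_algebra borel" "\<kappa> \<in> \<mu> \<rightarrow>\<^sub>M prob_algebra borel"
    using dis by (auto simp: disintegration_def intro: measurable_prob_algebraD)
  have meas [measurable]: "pullback \<kappa> \<beta> \<in> borel_measurable \<mu>"
    unfolding pullback_def by (rule measurable_compose[OF \<kappa>(1) integral_measurable_subprob_algebra]) measurable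
  have \<beta>snd: "(\<lambda>z::'a \<times> 'a. ennreal ((norm (\<beta> (snd z)))\<^sup>2)) \<in> borel_measurable borel"
    using measurable_compose[OF measurable_snd_borel \<open>\<beta> \<in> borel_measurable borel\<close>] by measurable
  have jensen: "ennreal ((norm (pullback \<kappa> \<beta> x))\<^sup>2) \<le> (\<integral>\<^sup>+y. ennreal ((norm (\<beta> y))\<^sup>2) \<partial>\<kappa> x)"
    if x: "x \<in> space \<mu>" for x
  proof (cases "(\<integral>\<^sup>+y. ennreal ((norm (\<beta> y))\<^sup>2) \<partial>\<kappa> x) = \<infinity>")
    case False
    have "prob_space (\<kappa> x)" and s: "sets (\<kappa> x) = sets borel"
      using measurable_space[OF \<kappa>(2) x] by (auto simp: space_prob_algebra)
    then interpret \<kappa>: prob_space "\<kappa> x" by simp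
    have [measurable]: "\<beta> \<in> borel_measurable (\<kappa> x)"
      using s by (simp cong: measurable_cong_sets)
    have L2: "\<beta> \<in> L2 (\<kappa> x)"
      using False by (intro L2I integrableI_nonneg) (auto simp: less_top)
    have "ennreal ((norm (pullback \<kappa> \<beta> x))\<^sup>2) \<le> ennreal (LINT y|\<kappa> x. (norm (\<beta> y))\<^sup>2)"
      unfolding pullback_def by (intro ennreal_leI \<kappa>.norm_integral_power2_le L2)
    also have "\<dots> = (\<integral>\<^sup>+y. ennreal ((norm (\<beta> y))\<^sup>2) \<partial>\<kappa> x)"
      using L2_integrable[OF L2] by (simp add: nn_integral_eq_integral)
    finally show ?thesis .
  qed simp
  have "(\<integral>\<^sup>+x. ennreal ((norm (pullback \<kappa> \<beta> x))\<^sup>2) \<partial>\<mu>)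
      \<le> (\<integral>\<^sup>+x. \<integral>\<^sup>+y. ennreal ((norm (\<beta> y))\<^sup>2) \<partial>\<kappa> x \<partial>\<mu>)"
    by (intro nn_integral_mono jensen)
  also have "\<dots> = (\<integral>\<^sup>+z. ennreal ((norm (\<beta> (snd z)))\<^sup>2) \<partial>\<gamma>)"
    by (simp add: disintegration_nn_integral[OF dis sets(1,2) \<beta>snd])
  also have "\<dots> = (\<integral>\<^sup>+y. ennreal ((norm (\<beta> y))\<^sup>2) \<partial>distr \<gamma> borel snd)"
    using sets(1) measurable_snd_borel[where 'a='a and 'b='a]
    by (subst nn_integral_distr) (simp_all cong: measurable_cong_sets)
  also have "distr \<gamma> borel snd = \<nu>"
    using \<gamma> by (simp add: couplings_def)
  also have "(\<integral>\<^sup>+y. ennreal ((norm (\<beta> y))\<^sup>2) \<partial>\<nu>) = ennreal (LINT y|\<nu>. (norm (\<beta> y))\<^sup>2)"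
    using L2_integrable[OF \<beta>] by (simp add: nn_integral_eq_integral)
  finally have le: "(\<integral>\<^sup>+x. ennreal ((norm (pullback \<kappa> \<beta> x))\<^sup>2) \<partial>\<mu>) \<le> ennreal (LINT y|\<nu>. (norm (\<beta> y))\<^sup>2)" .
  show L2: "pullback \<kappa> \<beta> \<in> L2 \<mu>"
    by (intro L2I integrableI_nonneg) (auto intro: le_less_trans[OF le])
  have "(LINT x|\<mu>. (norm (pullback \<kappa> \<beta> x))\<^sup>2) \<le> (LINT y|\<nu>. (norm (\<beta> y))\<^sup>2)"
    using le L2_integrable[OF L2] by (simp add: nn_integral_eq_integral integral_nonneg_AE)
  then show "L2_norm \<mu> (pullback \<kappa> \<beta>) \<le> L2_norm \<nu> \<beta>"
    by (simp add: L2_norm_def)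
qed

text \<open>Pulling back is adjoint to reading a map on the first factor through
  \<open>\<gamma>\<close>: on the fibre over \<open>x\<close> the vector \<open>w x\<close> is
  constant and leaves the inner integral.\<close>

lemma pullback_inner:
  fixes \<gamma> :: "('a::euclidean_space \<times> 'a) measure"
  assumes dis: "disintegration \<gamma> \<mu> \<kappa>" and \<gamma>: "\<gamma> \<in> couplings \<mu> \<nu>" and \<beta>: "\<beta> \<in> L2 \<nu>" and w: "w \<in> L2 \<mu>"
  shows "L2_inner \<mu> (pullback \<kappa> \<beta>) w = (LINT z|\<gamma>. \<beta> (snd z) \<bullet> w (fst z))"
proof -
  have sets: "sets \<gamma> = sets borel" "sets \<mu> = sets borel" "sets \<nu> = sets borel"
    and marg: "distr \<gamma> borel fst = \<mu>" "distr \<gamma> borel snd = \<nu>"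
    using \<gamma> by (auto simp: couplings_def)
  have m: "\<beta> \<in> borel_measurable borel" "w \<in> borel_measurable borel"
    using L2_measurable[OF \<beta>] L2_measurable[OF w] sets by (simp_all cong: measurable_cong_sets)
  have pm: "fst \<in> borel_measurable \<gamma>" "snd \<in> borel_measurable \<gamma>"
    using sets(1) measurable_fst_borel measurable_snd_borel by (simp_all cong: measurable_cong_sets)
  have \<beta>\<gamma>: "(\<lambda>z. \<beta> (snd z)) \<in> L2 \<gamma>" and w\<gamma>: "(\<lambda>z. w (fst z)) \<in> L2 \<gamma>"
    using L2_distr_iff[OF pm(2) m(1)] L2_distr_iff[OF pm(1) m(2)] \<beta> w by (simp_all add: marg)
  have \<kappa>: "\<kappa> \<in> \<mu> \<rightarrow>\<^sub>M prob_algebra borel"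
    using dis by (auto simp: disintegration_def)
  have "integrable \<gamma> (\<lambda>z. (norm (\<beta> (snd z)))\<^sup>2)"
    by (rule L2_integrable[OF \<beta>\<gamma>])
  from disintegration_integral(1)[OF dis sets(1,2) this]
  have "AE x in \<mu>. integrable (\<kappa> x) (\<lambda>y. (norm (\<beta> y))\<^sup>2)"
    by simp
  \<comment> \<open>Taking \<open>w x\<close> out of the integral uses integrability of
    \<open>\<beta>\<close> on almost every fibre.\<close>
  then have int: "AE x in \<mu>. integrable (\<kappa> x) \<beta>"
    using AE_space
  proof eventually_elim
    case (elim x)
    have "prob_space (\<kappa> x)" and s: "sets (\<kappa> x) = sets borel"
      using measurable_space[OF \<kappa> elim(2)] by (auto simp: space_prob_algebra)
    have "\<beta> \<in> L2 (\<kappa> x)"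
      using elim(1) s m(1) by (intro L2I) (simp_all cong: measurable_cong_sets)
    then show ?case
      using \<open>prob_space (\<kappa> x)\<close> prob_space.norm_integral_power2_le(1) by blast
  qed
  have "(LINT z|\<gamma>. \<beta> (snd z) \<bullet> w (fst z)) = (LINT x|\<mu>. LINT y|\<kappa> x. \<beta> y \<bullet> w x)"
    using disintegration_integral(2)[OF dis sets(1,2) L2_inner_integrable[OF \<beta>\<gamma> w\<gamma>]] by simp
  also have "\<dots> = (LINT x|\<mu>. pullback \<kappa> \<beta> x \<bullet> w x)"
  proof (rule integral_cong_AE)
    show "AE x in \<mu>. (LINT y|\<kappa> x. \<beta> y \<bullet> w x) = pullback \<kappa> \<beta> x \<bullet> w x"
      using int by eventually_elim (simp add: pullback_def)
    show pw: "(\<lambda>x. pullback \<kappa> \<beta> x \<bullet> w x) \<in> borel_measurable \<mu>"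
      using L2_inner_integrable[OF pullback_L2(1)[OF dis \<gamma> \<beta>] w] by (rule borel_measurable_integrable)
    have "(\<lambda>z. \<beta> (snd z) \<bullet> w (fst z)) \<in> borel_measurable borel"
      by (intro borel_measurable_inner measurable_compose[OF measurable_snd_borel m(1)]
          measurable_compose[OF measurable_fst_borel m(2)])
    from measurable_kernel_integral[OF measurable_prob_algebraD[OF \<kappa>] sets(2) this]
    show "(\<lambda>x. LINT y|\<kappa> x. \<beta> y \<bullet> w x) \<in> borel_measurable \<mu>"
      by simp
  qed
  finally show ?thesis
    by (simp add: L2_inner_def)
qed

section \<open>Test maps\<close>

lemma C1_mapsE:
  assumes "w \<in> C1_maps"
  obtains c where "0 \<le> c" "\<And>x. norm (w x) \<le> c * (1 + norm x)"
proof -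
  obtain c where c: "\<And>x. norm (w x) / (1 + norm x) \<le> c"
    using assms by (auto simp: C1_maps_def bdd_above_def)
  have "norm (w x) \<le> c * (1 + norm x)" for x
    using c[of x] add_pos_nonneg[OF zero_less_one norm_ge_zero[of x]] by (simp add: pos_divide_le_eq)
  moreover have "0 \<le> c"
    using order_trans[OF _ c[of 0]] by simp
  ultimately show thesis
    using that by blast
qed

lemma C1_maps_measurable: "w \<in> C1_maps \<Longrightarrow> w \<in> borel_measurable borel"
  by (simp add: C1_maps_def borel_measurable_continuous_onI)

lemma (in prob_space) L2_C1_maps:
  assumes w: "w \<in> C1_maps" and X: "X \<in> L2 M"
  shows "(\<lambda>\<omega>. w (X \<omega>)) \<in> L2 M"
proof -
  obtain c where c: "0 \<le> c" "\<And>x. norm (w x) \<le> c * (1 + norm x)"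
    using C1_mapsE[OF w] by blast
  have "(norm (w x))\<^sup>2 \<le> 2 * c\<^sup>2 + 2 * c\<^sup>2 * (norm x)\<^sup>2" for x
  proof -
    have "(norm (w x))\<^sup>2 \<le> (c * (1 + norm x))\<^sup>2"
      by (intro power_mono c) simp
    also have "\<dots> \<le> c\<^sup>2 * (2 + 2 * (norm x)\<^sup>2)"
      using norm_add_power2_le[of 1 "norm x"] by (simp add: power_mult_distrib mult_left_mono)
    finally show ?thesis
      by (simp add: algebra_simps)
  qed
  then show ?thesis
    using L2_integrable[OF X]
    by (intro L2_bound[where h="\<lambda>\<omega>. 2 * c\<^sup>2 + 2 * c\<^sup>2 * (norm (X \<omega>))\<^sup>2"]
        measurable_compose[OF L2_measurable[OF X] C1_maps_measurable[OF w]]) auto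
qed

text \<open>Dominated convergence: at each point the indicator vanishes once \<open>n\<close>
  exceeds \<open>g x\<close>.\<close>

lemma (in prob_space) L2_norm_tail_tendsto_zero:
  fixes f :: "'a \<Rightarrow> real"
  assumes f: "f \<in> L2 M" and g [measurable]: "g \<in> borel_measurable M"
  shows "(\<lambda>n. L2_norm M (\<lambda>x. f x * indicator {real n<..} (g x))) \<longlonglongrightarrow> 0"
proof -
  note [measurable] = L2_measurable[OF f]
  have "(\<lambda>n. LINT x|M. (norm (f x * indicator {real n<..} (g x)))\<^sup>2) \<longlonglongrightarrow> (LINT x|M. 0)"
  proof (rule integral_dominated_convergence[where w="\<lambda>x. (norm (f x))\<^sup>2"])
    show "integrable M (\<lambda>x. (norm (f x))\<^sup>2)"
      by (rule L2_integrable[OF f])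
    show "AE x in M. (\<lambda>n. (norm (f x * indicator {real n<..} (g x)))\<^sup>2) \<longlonglongrightarrow> 0"
    proof (rule AE_I2)
      fix x
      obtain N :: nat where N: "g x \<le> real N"
        using real_arch_simple by blast
      have "\<forall>\<^sub>F n in sequentially. (norm (f x * indicator {real n<..} (g x)))\<^sup>2 = 0"
        using eventually_ge_at_top[of N] by eventually_elim (use N in \<open>auto simp: indicator_def\<close>)
      then show "(\<lambda>n. (norm (f x * indicator {real n<..} (g x)))\<^sup>2) \<longlonglongrightarrow> 0"
        by (rule tendsto_eventually)
    qed
    show "AE x in M. norm ((norm (f x * indicator {real n<..} (g x)))\<^sup>2) \<le> (norm (f x))\<^sup>2" for n
      by (auto simp: indicator_def)
  qed simp_all
  then have "(\<lambda>n. sqrt (LINT x|M. (norm (f x * indicator {real n<..} (g x)))\<^sup>2)) \<longlonglongrightarrow> sqrt 0"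
    by (intro tendsto_real_sqrt) simp
  then show ?thesis
    by (simp add: L2_norm_def)
qed

lemma (in prob_space) L2_norm_mono:
  assumes "g \<in> L2 M" "f \<in> borel_measurable M" "\<And>x. norm (f x) \<le> norm (g x)"
  shows "L2_norm M f \<le> L2_norm M g"
proof (rule power2_le_imp_le)
  have "(L2_norm M f)\<^sup>2 \<le> (LINT x|M. (norm (g x))\<^sup>2)"
    by (intro L2_norm_le L2_integrable assms AE_I2 power_mono) simp
  then show "(L2_norm M f)\<^sup>2 \<le> (L2_norm M g)\<^sup>2"
    by (simp add: L2_norm_power2)
qed simp

text \<open>Three regimes: on a large ball \<open>w\<close> is uniformly continuous, which controls nearby points;
  distant points there are controlled by the linear growth of \<open>w\<close>; outside the ball the
  growth bound is used, whose contribution is a tail of a square-integrable function.\<close>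

lemma C1_maps_modulus:
  fixes w :: "'a::euclidean_space \<Rightarrow> 'a"
  assumes w: "w \<in> C1_maps" and growth: "0 \<le> c" "\<And>x. norm (w x) \<le> c * (1 + norm x)" and "0 < \<delta>" "0 \<le> R"
  obtains K where "0 \<le> K"
    "\<And>x y. norm (w y - w x) \<le> \<delta> + K * norm (y - x) + 2 * c * (1 + norm x) * indicator {R<..} (norm x)"
proof -
  have "uniformly_continuous_on (cball 0 (R + 1)) w"
    using w by (intro compact_uniformly_continuous) (auto simp: C1_maps_def intro: continuous_on_subset)
  then obtain \<theta>' where \<theta>': "0 < \<theta>'"
    "\<And>x y. x \<in> cball 0 (R + 1) \<Longrightarrow> y \<in> cball 0 (R + 1) \<Longrightarrow> dist y x < \<theta>' \<Longrightarrow> dist (w y) (w x) < \<delta>"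
    using \<open>0 < \<delta>\<close> unfolding uniformly_continuous_on_def by metis
  define \<theta> where "\<theta> = min \<theta>' 1"
  have \<theta>: "0 < \<theta>" "\<theta> \<le> \<theta>'" "\<theta> \<le> 1"
    using \<theta>'(1) by (auto simp: \<theta>_def)
  \<comment> \<open>The first summand handles points of the ball at distance at least
    \<open>\<theta>\<close>, where \<open>norm (y - x) / \<theta>\<close> is at least 1; the second
    is the linear growth in \<open>y - x\<close>.\<close>
  define K where "K = c * (2 + 2 * R) / \<theta> + c"
  have K: "c \<le> K" "0 \<le> K"
    using \<theta> growth(1) \<open>0 \<le> R\<close> by (auto simp: K_def)
  have "norm (w y - w x) \<le> \<delta> + K * norm (y - x) + 2 * c * (1 + norm x) * indicator {R<..} (norm x)" for x y
  proof -
    have "norm y \<le> norm x + norm (y - x)"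
      by (rule norm_triangle_sub)
    then have "c * (1 + norm y) \<le> c * (1 + norm x) + c * norm (y - x)"
      using mult_left_mono[of "1 + norm y" "1 + norm x + norm (y - x)" c] growth(1) by (simp add: algebra_simps)
    then have lin: "norm (w y - w x) \<le> 2 * c * (1 + norm x) + c * norm (y - x)"
      using norm_triangle_ineq4[of "w y" "w x"] growth(2)[of x] growth(2)[of y] by linarith
    have cK: "c * norm (y - x) \<le> K * norm (y - x)" "0 \<le> K * norm (y - x)"
      using K by (auto intro: mult_right_mono)
    consider "R < norm x" | "norm x \<le> R" "norm (y - x) < \<theta>" | "norm x \<le> R" "\<theta> \<le> norm (y - x)"
      by linarith
    then show ?thesis
    proof cases
      case 1
      then show ?thesis
        using lin cK \<open>0 < \<delta>\<close> by simp
    next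
      case 2
      then have "norm y \<le> R + 1"
        using norm_triangle_sub[of y x] \<theta> by linarith
      then have "dist (w y) (w x) < \<delta>"
        using 2 \<theta> by (intro \<theta>'(2)) (auto simp: dist_norm)
      then show ?thesis
        using 2 cK by (simp add: dist_norm)
    next
      case 3
      have "2 * c * (1 + norm x) \<le> c * (2 + 2 * R)"
        using 3 growth(1) mult_left_mono[of "2 + 2 * norm x" "2 + 2 * R" c] by (simp add: algebra_simps)
      also have "\<dots> \<le> c * (2 + 2 * R) * (norm (y - x) / \<theta>)"
        using mult_left_mono[of 1 "norm (y - x) / \<theta>" "c * (2 + 2 * R)"] 3 \<theta>(1) growth(1) \<open>0 \<le> R\<close> by simp
      finally have "2 * c * (1 + norm x) + c * norm (y - x) \<le> K * norm (y - x)"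
        by (simp add: K_def distrib_right)
      then show ?thesis
        using lin \<open>0 < \<delta>\<close> 3 by simp
    qed
  qed
  then show thesis
    using that K(2) by blast
qed

text \<open>The same \<open>\<beta>\<close> serves every \<open>X\<close> of law
  \<open>\<mu>\<close>, since the only term not controlled by \<open>Y - X\<close> is a tail whose
  norm depends on the law alone.\<close>

lemma (in prob_space) C1_maps_L2_continuous:
  fixes w :: "'b::euclidean_space \<Rightarrow> 'b"
  assumes w: "w \<in> C1_maps" and \<mu>: "\<mu> \<in> P2" and "0 < \<delta>"
  obtains \<beta> where "0 < \<beta>"
    "\<And>X Y. X \<in> L2 M \<Longrightarrow> Y \<in> L2 M \<Longrightarrow> distr M borel X = \<mu> \<Longrightarrow> L2_norm M (\<lambda>\<omega>. Y \<omega> - X \<omega>) \<le> \<beta>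
       \<Longrightarrow> L2_norm M (\<lambda>\<omega>. w (Y \<omega>) - w (X \<omega>)) \<le> \<delta>"
proof -
  interpret \<mu>: prob_space \<mu>
    using \<mu> by (simp add: P2_iff)
  obtain c where c: "0 \<le> c" "\<And>x. norm (w x) \<le> c * (1 + norm x)"
    using C1_mapsE[OF w] by blast
  define f :: "'b \<Rightarrow> real" where "f x = 2 * c * (1 + norm x)" for x
  have f [measurable]: "f \<in> borel_measurable borel"
    unfolding f_def by measurable
  have id: "(\<lambda>x. x) \<in> L2 \<mu>" and sets: "sets \<mu> = sets borel"
    using \<mu> by (auto simp: P2_iff)
  have "(\<lambda>x. norm x) \<in> L2 \<mu>"
    using id by (auto simp: L2_def)
  then have f\<mu>: "f \<in> L2 \<mu>"
    using L2_scaleR[OF L2_add[OF \<mu>.L2_const[of 1]], of "\<lambda>x. norm x" "2 * c"] by (simp add: f_def[abs_def])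
  define g where "g n x = f x * indicator {real n<..} (norm x)" for n x
  have gm [measurable]: "g n \<in> borel_measurable borel" for n
    unfolding g_def by measurable
  have "(\<lambda>n. L2_norm \<mu> (g n)) \<longlonglongrightarrow> 0"
    unfolding g_def using L2_measurable[OF id] by (intro \<mu>.L2_norm_tail_tendsto_zero f\<mu>) simp
  then have "\<forall>\<^sub>F n in sequentially. L2_norm \<mu> (g n) < \<delta> / 3"
    by (rule order_tendstoD) (use \<open>0 < \<delta>\<close> in simp)
  then obtain n where n: "L2_norm \<mu> (g n) < \<delta> / 3"
    by (auto simp: eventually_sequentially)
  obtain K where K: "0 \<le> K" "\<And>x y. norm (w y - w x) \<le> \<delta> / 3 + K * norm (y - x) + g n x"
    using C1_maps_modulus[OF w c, of "\<delta> / 3" "real n"] \<open>0 < \<delta>\<close> by (auto simp: g_def f_def)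
  \<comment> \<open>The radius \<open>n\<close> is fixed first, then \<open>K\<close>, then
    \<open>\<beta>\<close>; each of the three terms receives \<open>\<delta> / 3\<close>.\<close>
  define \<beta> where "\<beta> = \<delta> / (3 * (K + 1))"
  have \<beta>: "0 < \<beta>" "K * \<beta> \<le> \<delta> / 3"
    using \<open>0 < \<delta>\<close> K(1) by (auto simp: \<beta>_def field_simps)
  have g\<mu>: "g n \<in> L2 \<mu>"
    using L2_integrable[OF f\<mu>] sets
    by (intro L2_bound[where h="\<lambda>x. (norm (f x))\<^sup>2"]) (auto simp: g_def indicator_def cong: measurable_cong_sets)
  show thesis
  proof (rule that[OF \<beta>(1)])
    fix X Y assume X: "X \<in> L2 M" and Y: "Y \<in> L2 M" and law: "distr M borel X = \<mu>"
      and le: "L2_norm M (\<lambda>\<omega>. Y \<omega> - X \<omega>) \<le> \<beta>"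
    note [measurable] = L2_measurable[OF X] L2_measurable[OF Y] C1_maps_measurable[OF w]
    have gX: "(\<lambda>\<omega>. g n (X \<omega>)) \<in> L2 M" and gX_norm: "L2_norm M (\<lambda>\<omega>. g n (X \<omega>)) = L2_norm \<mu> (g n)"
      using g\<mu> L2_distr_iff[OF L2_measurable[OF X] gm] L2_norm_distr[OF L2_measurable[OF X] gm] by (simp_all add: law)
    have d: "(\<lambda>\<omega>. norm (Y \<omega> - X \<omega>)) \<in> L2 M"
      using L2_diff[OF Y X] by (auto simp: L2_def)
    then have Kd: "(\<lambda>\<omega>. K * norm (Y \<omega> - X \<omega>)) \<in> L2 M"
      using L2_scaleR[OF d, of K] by simp
    have Kd_norm: "L2_norm M (\<lambda>\<omega>. K * norm (Y \<omega> - X \<omega>)) = K * L2_norm M (\<lambda>\<omega>. Y \<omega> - X \<omega>)"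
      using L2_norm_scaleR[of M K "\<lambda>\<omega>. norm (Y \<omega> - X \<omega>)"] K(1) by (simp add: L2_norm_def)
    have "L2_norm M (\<lambda>\<omega>. w (Y \<omega>) - w (X \<omega>)) \<le> L2_norm M (\<lambda>\<omega>. \<delta> / 3 + K * norm (Y \<omega> - X \<omega>) + g n (X \<omega>))"
      by (intro L2_norm_mono L2_add L2_const Kd gX) (measurable, simp, rule order_trans[OF K(2) abs_ge_self])
    also have "\<dots> \<le> L2_norm M (\<lambda>\<omega>. \<delta> / 3 + K * norm (Y \<omega> - X \<omega>)) + L2_norm M (\<lambda>\<omega>. g n (X \<omega>))"
      by (intro L2_norm_triangle L2_add L2_const Kd gX)
    also have "L2_norm M (\<lambda>\<omega>. \<delta> / 3 + K * norm (Y \<omega> - X \<omega>))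
        \<le> L2_norm M (\<lambda>\<omega>. \<delta> / 3) + L2_norm M (\<lambda>\<omega>. K * norm (Y \<omega> - X \<omega>))"
      by (intro L2_norm_triangle L2_const Kd)
    also have "L2_norm M (\<lambda>\<omega>. \<delta> / 3) \<le> \<delta> / 3"
      using \<open>0 < \<delta>\<close> by (intro L2_norm_le_const) auto
    also have "L2_norm M (\<lambda>\<omega>. K * norm (Y \<omega> - X \<omega>)) \<le> \<delta> / 3"
      unfolding Kd_norm using mult_left_mono[OF le K(1)] \<beta>(2) by linarith
    finally show "L2_norm M (\<lambda>\<omega>. w (Y \<omega>) - w (X \<omega>)) \<le> \<delta>"
      using n by (simp add: gX_norm)
  qed
qed

section \<open>Gradients and difference quotients\<close>

text \<open>Moving mass along the gradient itself gains \<open>s * n\<^sup>2\<close> to first order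
  at displacement \<open>s * n\<close>, while the Lipschitz bound allows a gain of at most
  \<open>L * (s * n)\<close>.\<close>

lemma has_W2_gradient_norm_le:
  fixes \<xi> :: "'a::euclidean_space \<Rightarrow> 'a"
  assumes m: "m \<in> P2" and grad: "has_W2_gradient F \<xi> m" and "0 \<le> L"
    and Lip: "\<And>\<gamma>. \<gamma> \<in> P2 \<Longrightarrow> distr \<gamma> borel fst = m \<Longrightarrow> F (distr \<gamma> borel snd) - F m \<le> L * displacement \<gamma>"
  shows "L2_norm m \<xi> \<le> L"
proof (rule field_le_epsilon)
  fix \<eta> :: real assume "0 < \<eta>"
  interpret m: prob_space m
    using m by (simp add: P2_iff)
  define n where "n = L2_norm m \<xi>"
  show "L2_norm m \<xi> \<le> L + \<eta>"
  proof (cases "n = 0")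
    case True
    then show ?thesis
      using \<open>0 \<le> L\<close> \<open>0 < \<eta>\<close> by (simp add: n_def)
  next
    case False
    then have n: "0 < n"
      by (simp add: n_def order_less_le)
    have id: "(\<lambda>x. x) \<in> L2 m" and \<xi>: "\<xi> \<in> L2 m"
      using m grad by (auto simp: P2_iff has_W2_gradient_def)
    obtain \<delta> where \<delta>: "0 < \<delta>" "\<And>\<gamma>. \<gamma> \<in> P2 \<Longrightarrow> distr \<gamma> borel fst = m \<Longrightarrow> displacement \<gamma> \<le> \<delta> \<Longrightarrow>
        \<bar>F (distr \<gamma> borel snd) - F m - (LINT (x, y)|\<gamma>. \<xi> x \<bullet> (y - x))\<bar> \<le> \<eta> * displacement \<gamma>"
      using grad \<open>0 < \<eta>\<close> unfolding has_W2_gradient_def by blast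
    \<comment> \<open>This step size makes the displacement exactly \<open>\<delta>\<close>.\<close>
    define s where "s = \<delta> / n"
    have s: "0 < s" "s * n = \<delta>"
      using \<delta>(1) n by (auto simp: s_def)
    define T where "T x = (x, x + s *\<^sub>R \<xi> x)" for x
    have T: "T \<in> L2 m"
      unfolding T_def[abs_def] by (intro L2_Pair L2_add L2_scaleR id \<xi>)
    define \<gamma> where "\<gamma> = distr m borel T"
    have \<gamma>: "\<gamma> \<in> P2"
      unfolding \<gamma>_def by (rule m.L2_distr_P2[OF T])
    have fst: "distr \<gamma> borel fst = m"
      using m unfolding \<gamma>_def
      by (subst distr_distr) (auto simp: L2_measurable[OF T] comp_def T_def P2_iff intro: distr_id2)
    have disp: "displacement \<gamma> = s * n"
      using displacement_distr[OF L2_measurable[OF id] L2_measurable[OF L2_add[OF id L2_scaleR[OF \<xi>, of s]]]] s(1)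
      by (simp add: \<gamma>_def T_def[abs_def] L2_norm_scaleR n_def)
    have "\<xi> \<in> borel_measurable borel"
      using L2_measurable[OF \<xi>] m by (simp add: P2_iff cong: measurable_cong_sets)
    then have "(\<lambda>z. \<xi> (fst z) \<bullet> (snd z - fst z)) \<in> borel_measurable borel"
      by (intro borel_measurable_inner borel_measurable_diff measurable_fst_borel measurable_snd_borel
          measurable_compose[OF measurable_fst_borel])
    then have "(LINT (x, y)|\<gamma>. \<xi> x \<bullet> (y - x)) = (LINT x|m. s * (norm (\<xi> x))\<^sup>2)"
      unfolding \<gamma>_def case_prod_unfold
      by (subst integral_distr[OF L2_measurable[OF T]]) (simp_all add: T_def power2_norm_eq_inner)
    also have "\<dots> = s * n\<^sup>2"
      by (simp add: n_def L2_norm_power2)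
    finally have "s * n\<^sup>2 \<le> F (distr \<gamma> borel snd) - F m + \<eta> * (s * n)"
      using \<delta>(2)[OF \<gamma> fst] s(2) by (simp add: disp)
    also have "\<dots> \<le> L * (s * n) + \<eta> * (s * n)"
      using Lip[OF \<gamma> fst] by (simp add: disp)
    finally have "(s * n) * n \<le> (s * n) * (L + \<eta>)"
      by (simp add: power2_eq_square algebra_simps)
    then show ?thesis
      using s n \<delta>(1) by (simp add: n_def[symmetric])
  qed
qed

lemma couplings_P2:
  assumes \<gamma>: "\<gamma> \<in> couplings \<mu> \<nu>" and "\<mu> \<in> P2" "\<nu> \<in> P2"
  shows "\<gamma> \<in> P2"
proof -
  have sets: "sets \<gamma> = sets borel" and "prob_space \<gamma>"
    and marg: "distr \<gamma> borel fst = \<mu>" "distr \<gamma> borel snd = \<nu>"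
    using \<gamma> by (auto simp: couplings_def)
  interpret prob_space \<gamma> by fact
  have pm: "fst \<in> borel_measurable \<gamma>" "snd \<in> borel_measurable \<gamma>"
    using sets measurable_fst_borel measurable_snd_borel by (simp_all cong: measurable_cong_sets)
  have "(\<lambda>z. (fst z, snd z)) \<in> L2 \<gamma>"
    using distr_in_P2_iff[OF pm(1)] distr_in_P2_iff[OF pm(2)] assms(2,3) by (intro L2_Pair) (simp_all add: marg)
  then show ?thesis
    using sets \<open>prob_space \<gamma>\<close> by (simp add: P2_iff)
qed

context lipschitz_lift
begin

lemma lasry_lions_gradient_norm_le:
  assumes \<epsilon>: "0 < \<epsilon>" and m: "m \<in> P2" and grad: "has_W2_gradient (lasry_lions P G \<epsilon>) \<xi> m"
  shows "L2_norm m \<xi> \<le> L"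
proof (rule has_W2_gradient_norm_le[OF m grad L_nonneg])
  fix \<gamma> :: "('a \<times> 'a) measure" assume \<gamma>: "\<gamma> \<in> P2" and fst: "distr \<gamma> borel fst = m"
  obtain V where V: "V \<in> L2 P" "distr P borel V = \<gamma>"
    using realize[OF \<gamma>] by blast
  note Vm = L2_measurable[OF V(1)]
  note V12 = L2_fst[OF V(1)] L2_snd[OF V(1)]
  have "distr P borel (\<lambda>\<omega>. fst (V \<omega>)) = m" "distr P borel (\<lambda>\<omega>. snd (V \<omega>)) = distr \<gamma> borel snd"
    using Vm by (simp_all add: V(2)[symmetric] fst[symmetric] distr_distr comp_def)
  moreover have "displacement \<gamma> = L2_norm P (\<lambda>\<omega>. snd (V \<omega>) - fst (V \<omega>))"
    using displacement_distr[OF L2_measurable[OF V12(1)] L2_measurable[OF V12(2)]] V(2) by simp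
  ultimately show "lasry_lions P G \<epsilon> (distr \<gamma> borel snd) - lasry_lions P G \<epsilon> m \<le> L * displacement \<gamma>"
    using lasry_lions_Lipschitz[OF \<epsilon> V12] by simp
qed

text \<open>This is the estimate for a fixed \<open>\<epsilon>\<close>: the gradient is tested in
  the direction \<open>w (X0 \<omega>)\<close>, and the regularized increment is replaced by an
  increment of \<open>G\<close> at the law of a nearby \<open>Y\<close>.\<close>

lemma lasry_lions_gradient_le:
  assumes \<epsilon>: "0 < \<epsilon>" and X0: "X0 \<in> L2 P" and X: "X \<in> L2 P"
    and grad: "has_W2_gradient (lasry_lions P G \<epsilon>) \<xi> (distr P borel X)"
    and w: "w \<in> C1_maps" and close: "L2_norm P (\<lambda>\<omega>. X \<omega> - X0 \<omega>) + \<epsilon> * (4 * L + 1) \<le> \<beta>"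
    and modulus: "\<And>Y. Y \<in> L2 P \<Longrightarrow> L2_norm P (\<lambda>\<omega>. Y \<omega> - X0 \<omega>) \<le> \<beta> \<Longrightarrow>
      L2_norm P (\<lambda>\<omega>. w (Y \<omega>) - w (X0 \<omega>)) \<le> \<delta>"
    and "0 < \<tau>"
    and quotient: "\<And>\<nu> t. \<nu> \<in> P2 \<Longrightarrow> W2 \<nu> (distr P borel X0) \<le> \<beta> \<Longrightarrow> 0 < t \<Longrightarrow> t < \<tau> \<Longrightarrow>
      G (distr \<nu> borel (\<lambda>x. x + t *\<^sub>R w x)) - G \<nu> \<le> t * r"
  shows "(LINT \<omega>|P. \<xi> (X \<omega>) \<bullet> w (X0 \<omega>)) \<le> r + L * \<delta>"
proof (rule field_le_epsilon)
  fix e :: real assume "0 < e"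
  define W where "W \<omega> = w (X0 \<omega>)" for \<omega>
  have W: "W \<in> L2 P"
    unfolding W_def by (rule L2_C1_maps[OF w X0])
  define n where "n = L2_norm P W"
  have n: "0 \<le> n"
    by (simp add: n_def)
  define \<eta> where "\<eta> = e / (2 * (n + 1))"
  have \<eta>: "0 < \<eta>" "\<eta> * n \<le> e / 2"
    using \<open>0 < e\<close> n by (auto simp: \<eta>_def field_simps)
  obtain d where d: "0 < d" "\<And>\<gamma>. \<gamma> \<in> P2 \<Longrightarrow> distr \<gamma> borel fst = distr P borel X \<Longrightarrow> displacement \<gamma> \<le> d \<Longrightarrow>
      \<bar>lasry_lions P G \<epsilon> (distr \<gamma> borel snd) - lasry_lions P G \<epsilon> (distr P borel X)
        - (LINT (x, y)|\<gamma>. \<xi> x \<bullet> (y - x))\<bar> \<le> \<eta> * displacement \<gamma>"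
    using grad \<eta>(1) unfolding has_W2_gradient_def by blast
  \<comment> \<open>The bounds serve, in order, the difference quotient, the displacement
    \<open>t * n \<le> d\<close>, the absorption of \<open>2 * t\<close> into \<open>e / 2\<close>,
    and the admissibility of \<open>s = t * t\<close>.\<close>
  define t where "t = min (min (\<tau> / 2) (d / (n + 1))) (min (e / 4) (min 1 \<epsilon>))"
  have t: "0 < t" "t < \<tau>" "t \<le> d / (n + 1)" "t \<le> 1" "t \<le> \<epsilon>"
    using \<open>0 < \<tau>\<close> d(1) n \<open>0 < e\<close> \<epsilon> by (auto simp: t_def)
  have te: "t \<le> e / 4"
    unfolding t_def by (rule order_trans[OF min.cobounded2 min.cobounded1])
  have "t * n \<le> d / (n + 1) * n"
    using t(3) n by (rule mult_right_mono)
  also have "\<dots> \<le> d"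
    using n d(1) by (simp add: field_simps)
  finally have tn: "t * n \<le> d" .
  have "t * t \<le> 1 * t"
    using t by (intro mult_right_mono) auto
  with t(5) have "t * t \<le> \<epsilon>"
    by linarith
  then have tt: "0 < t * t" "t * t \<le> \<epsilon>"
    using t(1) by auto
  have tW: "(\<lambda>\<omega>. t *\<^sub>R W \<omega>) \<in> L2 P"
    by (rule L2_scaleR[OF W])
  have XtW: "(\<lambda>\<omega>. X \<omega> + t *\<^sub>R W \<omega>) \<in> L2 P"
    by (rule L2_add[OF X tW])
  define \<gamma> where "\<gamma> = distr P borel (\<lambda>\<omega>. (X \<omega>, X \<omega> + t *\<^sub>R W \<omega>))"
  have pair: "(\<lambda>\<omega>. (X \<omega>, X \<omega> + t *\<^sub>R W \<omega>)) \<in> L2 P"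
    by (rule L2_Pair[OF X XtW])
  have \<gamma>: "\<gamma> \<in> P2"
    unfolding \<gamma>_def by (rule L2_distr_P2[OF pair])
  have marg: "distr \<gamma> borel fst = distr P borel X"
    "distr \<gamma> borel snd = distr P borel (\<lambda>\<omega>. X \<omega> + t *\<^sub>R W \<omega>)"
    using L2_measurable[OF pair] by (simp_all add: \<gamma>_def distr_distr comp_def)
  have disp: "displacement \<gamma> = t * n"
    using displacement_distr[OF L2_measurable[OF X] L2_measurable[OF XtW]] t(1)
    by (simp add: \<gamma>_def n_def L2_norm_scaleR)
  define I where "I = (LINT \<omega>|P. \<xi> (X \<omega>) \<bullet> w (X0 \<omega>))"
  have "\<xi> \<in> borel_measurable borel"
    using grad L2_measurable[of \<xi> "distr P borel X"] by (simp add: has_W2_gradient_def)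
  then have "(\<lambda>z. \<xi> (fst z) \<bullet> (snd z - fst z)) \<in> borel_measurable borel"
    by (intro borel_measurable_inner borel_measurable_diff measurable_fst_borel measurable_snd_borel
        measurable_compose[OF measurable_fst_borel])
  then have "(LINT (x, y)|\<gamma>. \<xi> x \<bullet> (y - x)) = t * I"
    unfolding \<gamma>_def case_prod_unfold I_def
    by (subst integral_distr[OF L2_measurable[OF pair]]) (simp_all add: W_def)
  then have incr: "t * I \<le> lasry_lions P G \<epsilon> (distr P borel (\<lambda>\<omega>. X \<omega> + t *\<^sub>R W \<omega>))
      - lasry_lions P G \<epsilon> (distr P borel X) + \<eta> * (t * n)"
    using d(2)[OF \<gamma> marg(1)] tn by (simp add: disp marg)
  \<comment> \<open>The tolerance \<open>t * t\<close> is of higher order than \<open>t\<close>, so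
    it stays small after division by \<open>t\<close>.\<close>
  obtain Y where Y: "Y \<in> L2 P" and YX: "L2_norm P (\<lambda>\<omega>. Y \<omega> - X \<omega>) \<le> \<epsilon> * (4 * L + 1)"
    and incr_Y: "lasry_lions P G \<epsilon> (distr P borel (\<lambda>\<omega>. X \<omega> + t *\<^sub>R W \<omega>)) - lasry_lions P G \<epsilon> (distr P borel X)
       \<le> lift P G (\<lambda>\<omega>. Y \<omega> + t *\<^sub>R W \<omega>) - lift P G Y + 2 * (t * t)"
    using lasry_lions_increment[OF \<epsilon> X tW tt] by blast
  have YX0: "L2_norm P (\<lambda>\<omega>. Y \<omega> - X0 \<omega>) \<le> \<beta>"
    using L2_norm_triangle_diff[OF Y X X0] YX close by linarith
  have wY: "(\<lambda>\<omega>. w (Y \<omega>)) \<in> L2 P"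
    by (rule L2_C1_maps[OF w Y])
  have YtwY: "(\<lambda>\<omega>. Y \<omega> + t *\<^sub>R w (Y \<omega>)) \<in> L2 P"
    by (intro L2_add Y L2_scaleR wY)
  have "lift P G (\<lambda>\<omega>. Y \<omega> + t *\<^sub>R W \<omega>) \<le> lift P G (\<lambda>\<omega>. Y \<omega> + t *\<^sub>R w (Y \<omega>))
      + L * L2_norm P (\<lambda>\<omega>. (Y \<omega> + t *\<^sub>R w (Y \<omega>)) - (Y \<omega> + t *\<^sub>R W \<omega>))"
    using lift_Lipschitz[OF YtwY L2_add[OF Y tW]] by simp
  also have "L2_norm P (\<lambda>\<omega>. (Y \<omega> + t *\<^sub>R w (Y \<omega>)) - (Y \<omega> + t *\<^sub>R W \<omega>))
      = t * L2_norm P (\<lambda>\<omega>. w (Y \<omega>) - w (X0 \<omega>))"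
    using L2_norm_scaleR[of P t "\<lambda>\<omega>. w (Y \<omega>) - w (X0 \<omega>)"] t(1) by (simp add: W_def algebra_simps)
  also have "L * (t * L2_norm P (\<lambda>\<omega>. w (Y \<omega>) - w (X0 \<omega>))) \<le> L * (t * \<delta>)"
    using modulus[OF Y YX0] t(1) L_nonneg by (intro mult_left_mono) auto
  finally have step1: "lift P G (\<lambda>\<omega>. Y \<omega> + t *\<^sub>R W \<omega>) \<le> lift P G (\<lambda>\<omega>. Y \<omega> + t *\<^sub>R w (Y \<omega>)) + L * (t * \<delta>)"
    by simp
  have "W2 (distr P borel Y) (distr P borel X0) \<le> \<beta>"
    using W2_le_L2_norm[OF L2_measurable[OF Y] L2_measurable[OF X0]] YX0 by linarith
  then have "G (distr (distr P borel Y) borel (\<lambda>x. x + t *\<^sub>R w x)) - G (distr P borel Y) \<le> t * r"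
    by (rule quotient[OF L2_distr_P2[OF Y] _ t(1,2)])
  moreover have "distr (distr P borel Y) borel (\<lambda>x. x + t *\<^sub>R w x) = distr P borel (\<lambda>\<omega>. Y \<omega> + t *\<^sub>R w (Y \<omega>))"
    using L2_measurable[OF Y] C1_maps_measurable[OF w] by (subst distr_distr) (simp_all add: comp_def)
  ultimately have step2: "lift P G (\<lambda>\<omega>. Y \<omega> + t *\<^sub>R w (Y \<omega>)) - lift P G Y \<le> t * r"
    by (simp add: lift_def)
  have "t * I \<le> t * r + L * (t * \<delta>) + 2 * (t * t) + \<eta> * (t * n)"
    using incr incr_Y step1 step2 by linarith
  also have "\<dots> = t * (r + L * \<delta> + 2 * t + \<eta> * n)"
    by (simp add: algebra_simps)
  finally have "I \<le> r + L * \<delta> + 2 * t + \<eta> * n"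
    using t(1) by (rule mult_left_le_imp_le)
  then show "(LINT \<omega>|P. \<xi> (X \<omega>) \<bullet> w (X0 \<omega>)) \<le> r + L * \<delta> + e"
    using te \<eta>(2) by (simp add: I_def)
qed

end

text \<open>Realizing both laws on the same space shows that couplings exist, so the infimum is over
  a nonempty set.\<close>

lemma (in rich_space) W2_nonneg:
  fixes \<mu> \<nu> :: "'a::euclidean_space measure"
  assumes "\<mu> \<in> P2" "\<nu> \<in> P2"
  shows "0 \<le> W2 \<mu> \<nu>"
proof -
  obtain X Y where "X \<in> L2 P" "distr P borel X = \<mu>" "Y \<in> L2 P" "distr P borel Y = \<nu>"
    using realize[OF assms(1)] realize[OF assms(2)] by metis
  then have "couplings \<mu> \<nu> \<noteq> {}"
    using distr_Pair_couplings[of X Y] L2_measurable by blast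
  then show ?thesis
    unfolding W2_def by (intro cINF_greatest) (auto simp: displacement_def)
qed

text \<open>The constant in the definition may be negative; since \<open>W2\<close> is nonnegative
  it can be raised to \<open>max L 0\<close>.\<close>

lemma (in rich_space) W2_LipschitzE:
  fixes G :: "'a::euclidean_space measure \<Rightarrow> real"
  assumes "W2_Lipschitz G"
  obtains L where "0 \<le> L" "\<And>\<mu> \<nu>. \<mu> \<in> P2 \<Longrightarrow> \<nu> \<in> P2 \<Longrightarrow> \<bar>G \<mu> - G \<nu>\<bar> \<le> L * W2 \<mu> \<nu>"
proof -
  obtain L where L: "\<And>\<mu> \<nu>. \<mu> \<in> P2 \<Longrightarrow> \<nu> \<in> P2 \<Longrightarrow> \<bar>G \<mu> - G \<nu>\<bar> \<le> L * W2 \<mu> \<nu>"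
    using assms by (auto simp: W2_Lipschitz_def)
  show thesis
  proof (rule that[of "max L 0"])
    fix \<mu> \<nu> :: "'a measure" assume "\<mu> \<in> P2" "\<nu> \<in> P2"
    then show "\<bar>G \<mu> - G \<nu>\<bar> \<le> max L 0 * W2 \<mu> \<nu>"
      using L[of \<mu> \<nu>] mult_right_mono[of L "max L 0" "W2 \<mu> \<nu>"] W2_nonneg[of \<mu> \<nu>] by simp
  qed simp
qed

lemma nonatomic_null_singleton:
  assumes "nonatomic P" "{x} \<in> sets P"
  shows "emeasure P {x} = 0"
proof (rule ccontr)
  assume "emeasure P {x} \<noteq> 0"
  then obtain B where B: "B \<subseteq> {x}" "0 < emeasure P B" "emeasure P B < emeasure P {x}"
    using assms unfolding nonatomic_def by (metis zero_less_iff_neq_zero)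
  then have "B = {} \<or> B = {x}"
    by blast
  then show False
    using B by auto
qed

section \<open>The Clarke derivative near \<open>\<mu>\<close> and the passage to the limit\<close>

lemma eventually_nhds_W2:
  "eventually Q (nhds_W2 \<mu>) \<longleftrightarrow> (\<exists>\<rho>>0. \<forall>\<nu>\<in>P2. W2 \<nu> \<mu> < \<rho> \<longrightarrow> Q \<nu>)"
proof -
  have "eventually Q (nhds_W2 \<mu>) \<longleftrightarrow> (\<exists>r\<in>{0::real<..}. eventually Q (principal {\<nu>\<in>P2. W2 \<nu> \<mu> < r}))"
    unfolding nhds_W2_def
  proof (rule eventually_INF_base)
    fix a b :: real assume "a \<in> {0<..}" "b \<in> {0<..}"
    then show "\<exists>r\<in>{0<..}. principal {\<nu>\<in>P2. W2 \<nu> \<mu> < r}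
        \<le> inf (principal {\<nu>\<in>P2. W2 \<nu> \<mu> < a}) (principal {\<nu>\<in>P2. W2 \<nu> \<mu> < b})"
      by (intro bexI[of _ "min a b"]) auto
  qed auto
  then show ?thesis
    by (auto simp: eventually_principal)
qed

lemma clarke_deriv_lessD:
  assumes "clarke_deriv G \<mu> w < ereal r"
  obtains \<rho> \<tau> where "0 < \<rho>" "0 < \<tau>"
    "\<And>\<nu> t. \<nu> \<in> P2 \<Longrightarrow> W2 \<nu> \<mu> < \<rho> \<Longrightarrow> 0 < t \<Longrightarrow> t < \<tau> \<Longrightarrow>
      G (distr \<nu> borel (\<lambda>x. x + t *\<^sub>R w x)) - G \<nu> \<le> t * r"
proof -
  have "\<forall>\<^sub>F z in nhds_W2 \<mu> \<times>\<^sub>F at_right 0.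
      (case z of (\<nu>, t) \<Rightarrow> ereal ((G (distr \<nu> borel (\<lambda>x. x + t *\<^sub>R w x)) - G \<nu>) / t)) < ereal r"
    by (rule Limsup_lessD) (use assms in \<open>simp add: clarke_deriv_def\<close>)
  then obtain Q1 Q2 where Q: "eventually Q1 (nhds_W2 \<mu>)" "eventually Q2 (at_right (0::real))"
    "\<And>\<nu> t. Q1 \<nu> \<Longrightarrow> Q2 t \<Longrightarrow> (G (distr \<nu> borel (\<lambda>x. x + t *\<^sub>R w x)) - G \<nu>) / t < r"
    unfolding eventually_prod_filter by auto
  obtain \<rho> where \<rho>: "0 < \<rho>" "\<And>\<nu>. \<nu> \<in> P2 \<Longrightarrow> W2 \<nu> \<mu> < \<rho> \<Longrightarrow> Q1 \<nu>"
    using Q(1) unfolding eventually_nhds_W2 by blast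
  obtain \<tau> where \<tau>: "0 < \<tau>" "\<And>t. 0 < t \<Longrightarrow> t < \<tau> \<Longrightarrow> Q2 t"
    using Q(2) unfolding eventually_at_right_field by blast
  show thesis
  proof (rule that[OF \<rho>(1) \<tau>(1)])
    fix \<nu> t assume \<nu>: "\<nu> \<in> P2" "W2 \<nu> \<mu> < \<rho>" and t: "0 < (t::real)" "t < \<tau>"
    show "G (distr \<nu> borel (\<lambda>x. x + t *\<^sub>R w x)) - G \<nu> \<le> t * r"
      using Q(3)[OF \<rho>(2)[OF \<nu>] \<tau>(2)[OF t]] t(1) by (simp add: pos_divide_less_eq mult.commute)
  qed
qed

theorem proposition5p4:
  fixes P :: "'w::polish_space measure"
    and G :: "'a::euclidean_space measure \<Rightarrow> real"
    and \<mu> :: "'a measure"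
    and m :: "real \<Rightarrow> 'a measure"
    and \<Xi> :: "real \<Rightarrow> 'a \<Rightarrow> 'a"
    and \<gamma> :: "real \<Rightarrow> ('a \<times> 'a) measure"
    and \<kappa> :: "real \<Rightarrow> 'a \<Rightarrow> 'a measure"
  assumes "prob_space P" and "complete_measure P" and "sets borel \<subseteq> sets P" and "nonatomic P"
    and "W2_Lipschitz G"
    and "\<mu> \<in> P2" and "\<And>\<epsilon>. \<epsilon> > 0 \<Longrightarrow> m \<epsilon> \<in> P2"
    and "((\<lambda>\<epsilon>. W2 (m \<epsilon>) \<mu>) \<longlongrightarrow> 0) (at_right 0)"
    and "\<And>\<epsilon>. \<epsilon> > 0 \<Longrightarrow> has_W2_gradient (lasry_lions P G \<epsilon>) (\<Xi> \<epsilon>) (m \<epsilon>)"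
    and "\<And>\<epsilon>. \<epsilon> > 0 \<Longrightarrow> \<gamma> \<epsilon> \<in> couplings \<mu> (m \<epsilon>)"
    and "((\<lambda>\<epsilon>. displacement (\<gamma> \<epsilon>)) \<longlongrightarrow> 0) (at_right 0)"
    and "\<And>\<epsilon>. \<epsilon> > 0 \<Longrightarrow> disintegration (\<gamma> \<epsilon>) \<mu> (\<kappa> \<epsilon>)"
  shows "(\<exists>C. \<forall>\<epsilon>>0. pullback (\<kappa> \<epsilon>) (\<Xi> \<epsilon>) \<in> L2 \<mu> \<and> L2_norm \<mu> (pullback (\<kappa> \<epsilon>) (\<Xi> \<epsilon>)) \<le> C) \<and>
    (\<forall>\<xi> e. (\<forall>n. e n > 0) \<and> e \<longlonglongrightarrow> 0 \<and>
        L2_weakly_tendsto \<mu> (\<lambda>n. pullback (\<kappa> (e n)) (\<Xi> (e n))) \<xi> \<longrightarrow>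
      \<xi> \<in> clarke_subdiff G \<mu>)"
proof -
  have borel: "sets borel \<subseteq> sets P"
    by fact
  have "emeasure P {\<omega>} = 0" for \<omega>
    using borel by (intro nonatomic_null_singleton[OF \<open>nonatomic P\<close>]) auto
  then interpret rich_space P
    using \<open>prob_space P\<close> borel by (simp add: rich_space_def rich_space_axioms_def)
  obtain L where L: "0 \<le> L" "\<And>\<mu> \<nu>. \<mu> \<in> P2 \<Longrightarrow> \<nu> \<in> P2 \<Longrightarrow> \<bar>G \<mu> - G \<nu>\<bar> \<le> L * W2 \<mu> \<nu>"
    using W2_LipschitzE[OF \<open>W2_Lipschitz G\<close>] by blast
  interpret lipschitz_lift P G L
    by unfold_locales (fact L)+
  have grad: "has_W2_gradient (lasry_lions P G \<epsilon>) (\<Xi> \<epsilon>) (m \<epsilon>)" and m: "m \<epsilon> \<in> P2"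
    and \<gamma>: "\<gamma> \<epsilon> \<in> couplings \<mu> (m \<epsilon>)" and dis: "disintegration (\<gamma> \<epsilon>) \<mu> (\<kappa> \<epsilon>)" if "0 < \<epsilon>" for \<epsilon>
    using assms that by blast+
  have \<Xi>: "\<Xi> \<epsilon> \<in> L2 (m \<epsilon>)" if "0 < \<epsilon>" for \<epsilon>
    using grad[OF that] by (simp add: has_W2_gradient_def)
  have disp: "((\<lambda>\<epsilon>. displacement (\<gamma> \<epsilon>)) \<longlongrightarrow> 0) (at_right 0)"
    by fact
  interpret \<mu>: prob_space \<mu>
    using \<open>\<mu> \<in> P2\<close> by (simp add: P2_iff)
  have id: "(\<lambda>x. x) \<in> L2 \<mu>"
    using \<open>\<mu> \<in> P2\<close> by (simp add: P2_iff)
  \<comment> \<open>The gradients have norm at most \<open>L\<close>, and pulling back is a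
    contraction.\<close>
  have "pullback (\<kappa> \<epsilon>) (\<Xi> \<epsilon>) \<in> L2 \<mu>" "L2_norm \<mu> (pullback (\<kappa> \<epsilon>) (\<Xi> \<epsilon>)) \<le> L" if "0 < \<epsilon>" for \<epsilon>
    using pullback_L2[OF dis[OF that] \<gamma>[OF that] \<Xi>[OF that]]
      lasry_lions_gradient_norm_le[OF that m[OF that] grad[OF that]] by linarith+
  then have bounded: "\<exists>C. \<forall>\<epsilon>>0. pullback (\<kappa> \<epsilon>) (\<Xi> \<epsilon>) \<in> L2 \<mu> \<and> L2_norm \<mu> (pullback (\<kappa> \<epsilon>) (\<Xi> \<epsilon>)) \<le> C"
    by blast
  have limit: "\<xi> \<in> clarke_subdiff G \<mu>"
    if e: "\<And>n. e n > 0" "e \<longlonglongrightarrow> 0" and weak: "L2_weakly_tendsto \<mu> (\<lambda>n. pullback (\<kappa> (e n)) (\<Xi> (e n))) \<xi>"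
    for \<xi> e
  proof -
    have "ereal (L2_inner \<mu> \<xi> w) \<le> clarke_deriv G \<mu> w" if w: "w \<in> C1_maps" for w
    \<comment> \<open>It suffices to compare with real upper bounds \<open>r\<close> of the Clarke
      derivative, whose value is an extended real.\<close>
    proof (rule ereal_le_real)
      fix r :: real assume "clarke_deriv G \<mu> w \<le> ereal r"
      \<comment> \<open>The same \<open>\<delta>\<close> is the slack above \<open>r\<close> and the
        modulus of \<open>w\<close>; the latter enters multiplied by \<open>L\<close>.\<close>
      have *: "L2_inner \<mu> \<xi> w \<le> r + (1 + L) * \<delta>" if \<delta>: "0 < \<delta>" for \<delta>
      proof -
        have "clarke_deriv G \<mu> w < ereal (r + \<delta>)"
          using \<delta> by (intro le_less_trans[OF \<open>clarke_deriv G \<mu> w \<le> ereal r\<close>]) simp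
        then obtain \<rho> \<tau> where \<rho>: "0 < \<rho>" and \<tau>: "0 < \<tau>"
          and quot: "\<And>\<nu> t. \<nu> \<in> P2 \<Longrightarrow> W2 \<nu> \<mu> < \<rho> \<Longrightarrow> 0 < t \<Longrightarrow> t < \<tau> \<Longrightarrow>
            G (distr \<nu> borel (\<lambda>x. x + t *\<^sub>R w x)) - G \<nu> \<le> t * (r + \<delta>)"
          using clarke_deriv_lessD by blast
        obtain \<beta>' where \<beta>': "0 < \<beta>'" and
          modulus: "\<And>X Y. X \<in> L2 P \<Longrightarrow> Y \<in> L2 P \<Longrightarrow> distr P borel X = \<mu> \<Longrightarrow>
            L2_norm P (\<lambda>\<omega>. Y \<omega> - X \<omega>) \<le> \<beta>' \<Longrightarrow> L2_norm P (\<lambda>\<omega>. w (Y \<omega>) - w (X \<omega>)) \<le> \<delta>"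
          using C1_maps_L2_continuous[OF w \<open>\<mu> \<in> P2\<close> \<delta>] by blast
        \<comment> \<open>Halving \<open>\<rho>\<close> turns the closed ball of radius
          \<open>\<beta>\<close> into part of the open ball.\<close>
        define \<beta> where "\<beta> = min \<beta>' (\<rho> / 2)"
        have \<beta>: "0 < \<beta>" "\<beta> \<le> \<beta>'" "\<beta> < \<rho>"
          using \<beta>' \<rho> by (auto simp: \<beta>_def)
        have "filterlim e (at_right 0) sequentially"
          using e(2) by (rule tendsto_imp_filterlim_at_right) (simp add: e(1))
        from filterlim_compose[OF disp this]
        have "(\<lambda>n. displacement (\<gamma> (e n)) + e n * (4 * L + 1)) \<longlonglongrightarrow> 0 + 0 * (4 * L + 1)"
          by (intro tendsto_intros e(2))
        then have "\<forall>\<^sub>F n in sequentially. displacement (\<gamma> (e n)) + e n * (4 * L + 1) < \<beta>"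
          by (rule order_tendstoD) (use \<beta> in simp)
        then have "\<forall>\<^sub>F n in sequentially. L2_inner \<mu> (pullback (\<kappa> (e n)) (\<Xi> (e n))) w \<le> r + \<delta> + L * \<delta>"
        proof eventually_elim
          case (elim n)
          note \<epsilon> = e(1)[of n]
          note \<gamma>n = \<gamma>[OF \<epsilon>]
          \<comment> \<open>A single variable \<open>V\<close> of law \<open>\<gamma> (e n)\<close>
            provides both \<open>X0\<close> and \<open>X\<close>, with the displacement as their
            distance.\<close>
          obtain V where V: "V \<in> L2 P" "distr P borel V = \<gamma> (e n)"
            using realize[OF couplings_P2[OF \<gamma>n \<open>\<mu> \<in> P2\<close> m[OF \<epsilon>]]] by blast
          note V12 = L2_fst[OF V(1)] L2_snd[OF V(1)]
          have law: "distr P borel (\<lambda>\<omega>. fst (V \<omega>)) = \<mu>" "distr P borel (\<lambda>\<omega>. snd (V \<omega>)) = m (e n)"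
            using \<gamma>n L2_measurable[OF V(1)] by (auto simp: couplings_def V(2)[symmetric] distr_distr comp_def)
          have "displacement (\<gamma> (e n)) = L2_norm P (\<lambda>\<omega>. snd (V \<omega>) - fst (V \<omega>))"
            using displacement_distr[OF L2_measurable[OF V12(1)] L2_measurable[OF V12(2)]] V(2) by simp
          then have close: "L2_norm P (\<lambda>\<omega>. snd (V \<omega>) - fst (V \<omega>)) + e n * (4 * L + 1) \<le> \<beta>"
            using elim by simp
          have "\<Xi> (e n) \<in> borel_measurable borel"
            using L2_measurable[OF \<Xi>[OF \<epsilon>]] m[OF \<epsilon>] by (simp add: P2_iff cong: measurable_cong_sets)
          then have meas: "(\<lambda>z. \<Xi> (e n) (snd z) \<bullet> w (fst z)) \<in> borel_measurable borel"
            by (intro borel_measurable_inner measurable_compose[OF measurable_snd_borel]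
                measurable_compose[OF measurable_fst_borel] C1_maps_measurable[OF w])
          have "L2_inner \<mu> (pullback (\<kappa> (e n)) (\<Xi> (e n))) w = (LINT z|\<gamma> (e n). \<Xi> (e n) (snd z) \<bullet> w (fst z))"
            by (rule pullback_inner[OF dis[OF \<epsilon>] \<gamma>n \<Xi>[OF \<epsilon>] \<mu>.L2_C1_maps[OF w id]])
          also have "\<dots> = (LINT \<omega>|P. \<Xi> (e n) (snd (V \<omega>)) \<bullet> w (fst (V \<omega>)))"
            unfolding V(2)[symmetric] by (rule integral_distr[OF L2_measurable[OF V(1)] meas])
          also have "\<dots> \<le> r + \<delta> + L * \<delta>"
          proof (rule lasry_lions_gradient_le[OF \<epsilon> V12 _ w close _ \<tau>])
            show "has_W2_gradient (lasry_lions P G (e n)) (\<Xi> (e n)) (distr P borel (\<lambda>\<omega>. snd (V \<omega>)))"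
              using grad[OF \<epsilon>] by (simp add: law)
            show "L2_norm P (\<lambda>\<omega>. w (Y \<omega>) - w (fst (V \<omega>))) \<le> \<delta>"
              if "Y \<in> L2 P" "L2_norm P (\<lambda>\<omega>. Y \<omega> - fst (V \<omega>)) \<le> \<beta>" for Y
              using modulus[OF V12(1) that(1) law(1)] that(2) \<beta>(2) by linarith
            show "G (distr \<nu> borel (\<lambda>x. x + t *\<^sub>R w x)) - G \<nu> \<le> t * (r + \<delta>)"
              if "\<nu> \<in> P2" "W2 \<nu> (distr P borel (\<lambda>\<omega>. fst (V \<omega>))) \<le> \<beta>" "0 < t" "t < \<tau>" for \<nu> t
              using quot[OF that(1) _ that(3,4)] that(2) \<beta>(3) by (simp add: law)
          qed
          finally show ?case .
        qed
        \<comment> \<open>The test map \<open>w\<close> is itself square-integrable for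
          \<open>\<mu>\<close>, so weak convergence carries the bound to
          \<open>\<xi>\<close>.\<close>
        moreover have "(\<lambda>n. L2_inner \<mu> (pullback (\<kappa> (e n)) (\<Xi> (e n))) w) \<longlonglongrightarrow> L2_inner \<mu> \<xi> w"
          using weak \<mu>.L2_C1_maps[OF w id] by (simp add: L2_weakly_tendsto_def)
        ultimately have "L2_inner \<mu> \<xi> w \<le> r + \<delta> + L * \<delta>"
          by (intro tendsto_upperbound[OF _ _ sequentially_bot])
        then show ?thesis
          by (simp add: algebra_simps)
      qed
      have "L2_inner \<mu> \<xi> w \<le> r + d" if "0 < d" for d
        using *[of "d / (1 + L)"] L(1) that by simp
      then show "ereal (L2_inner \<mu> \<xi> w) \<le> ereal r"
        by (simp add: field_le_epsilon)
    qed
    then show ?thesis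
      using weak by (simp add: clarke_subdiff_def L2_weakly_tendsto_def)
  qed
  show ?thesis
    using bounded limit by blast
qed

end
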